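(* Let $\mathscr{X}=(\mathscr{X},\boxtimes,I)$ be a symmetric monoidal closed category, let $\mathbb{L}=(L,\eta,\mu)$ and $\mathbb{M}=(M,\delta,\kappa)$ be $\mathscr{X}$-monads on $\underline{\mathscr{X}}$, and let $\Delta:\mathbb{L}\to\mathbb{M}$ be a morphism of $\mathscr{X}$-monads. Assume that $\mathbb{L}$ is commutative and has tensor products of algebras, and that the Eilenberg–Moore $\mathscr{X}$-category for $\mathbb{L}$ exists. Then the following are equivalent: (1) $\Delta:\mathbb{L}\to\mathbb{M}$ is relatively commutative; (2) each extender $\Omega^{\kappa_Y}_X:\underline{\mathscr{X}}(X,MY)\to\underline{\mathscr{X}}(MX,MY)$ is an $\mathbb{L}$-homomorphism, where $X,Y\in\mathscr{X}$; (3) each extender $\Omega^a_X:\underline{\mathscr{X}}(X,Z)\to\underline{\mathscr{X}}(MX,Z)$ is an $\mathbb{L}$-homomorphism, where $(Z,a)$ is an $\mathbb{M}$-algebra and $X\in\mathscr{X}$.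
   Context: $\underline{\mathscr{X}}$ is $\mathscr{X}$ enriched in itself. For an $\mathscr{X}$-functor $T:\underline{\mathscr{X}}\to\underline{\mathscr{X}}$, $t'^T_{XY}:TX\boxtimes Y\to T(X\boxtimes Y)$ is the transpose of $Y\to\underline{\mathscr{X}}(X,X\boxtimes Y)\xrightarrow{T}\underline{\mathscr{X}}(TX,T(X\boxtimes Y))$ and $t''^T_{XY}:X\boxtimes TY\to T(X\boxtimes Y)$ is the transpose of $X\to\underline{\mathscr{X}}(Y,X\boxtimes Y)\xrightarrow{T}\underline{\mathscr{X}}(TY,T(X\boxtimes Y))$. An $\mathscr{X}$-monad $(T,\eta,\mu)$ on $\underline{\mathscr{X}}$ is commutative if $\otimes_{XY}:=\mu\cdot Tt'_{XY}\cdot t''_{TX,Y}$ equals $\mu\cdot Tt''_{XY}\cdot t'_{X,TY}$ as morphisms $TX\boxtimes TY\to T(X\boxtimes Y)$, for all $X,Y$. A commutative $\mathbb{L}$ has tensor products of algebras if for all $\mathbb{L}$-algebras $(X,a),(Y,b)$ the pair $\mu\cdot L\otimes_{XY},\ L(a\boxtimes b):(L(LX\boxtimes LY),\mu)\rightrightarrows(L(X\boxtimes Y),\mu)$ has a coequalizer in $\mathscr{X}^{\mathbb{L}}$. The Eilenberg–Moore $\mathscr{X}$-category of $\mathbb{L}$ exists if for all algebras $(X,a),(Y,b)$ the pair $\underline{\mathscr{X}}(LX,b)\cdot L_{XY},\ \underline{\mathscr{X}}(a,Y):\underline{\mathscr{X}}(X,Y)\rightrightarrows\underline{\mathscr{X}}(LX,Y)$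 has an equalizer in $\mathscr{X}$. A morphism of $\mathscr{X}$-monads $\Delta:\mathbb{L}\to\mathbb{M}$ on the same $\mathscr{X}$-category is an $\mathscr{X}$-natural transformation $\Delta:L\to M$ compatible with units and multiplications. Define, for $X,Y\in\mathscr{X}$, $$\otimes^\Delta_{XY}:=\kappa\cdot\Delta M\cdot Lt'^M_{XY}\cdot t''^L_{MX,Y},\qquad\widetilde{\otimes}^\Delta_{XY}:=\kappa\cdot M\Delta\cdot Mt''^L_{XY}\cdot t'^M_{X,LY},$$ both morphisms $MX\boxtimes LY\to M(X\boxtimes Y)$ (through $LM(X\boxtimes Y)\to MM(X\boxtimes Y)$ and $ML(X\boxtimes Y)\to MM(X\boxtimes Y)$ respectively). $\Delta$ is relatively commutative if $\otimes^\Delta_{XY}=\widetilde{\otimes}^\Delta_{XY}$ for all $X,Y\in\mathscr{X}$. Extenders. For an $\mathbb{M}$-algebra $(Z,a)$ and $X\in\mathscr{X}$, $\Omega^a_X$ is the composite $\underline{\mathscr{X}}(X,Z)\xrightarrow{M_{XZ}}\underline{\mathscr{X}}(MX,MZ)\xrightarrow{\underline{\mathscr{X}}(MX,a)}\underline{\mathscr{X}}(MX,Z)$; $\Omega^{\kappa_Y}_X$ is the extender for the free algebra $(MY,\kappa_Y)$. $\mathbb{L}$-algebra structures. The carrier $Z$ of an $\mathbb{M}$-algebra $(Z,a)$ is an $\mathbb{L}$-algebra with structure $a\cdot\Delta_Z$. For an $\mathbb{L}$-algebra $(Z,b)$ and $X\in\mathscr{X}$, $\underline{\mathscr{X}}(X,Z)$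 is an $\mathbb{L}$-algebra with (pointwise) structure $L\underline{\mathscr{X}}(X,Z)\xrightarrow{\varsigma}\underline{\mathscr{X}}(X,LZ)\xrightarrow{\underline{\mathscr{X}}(X,b)}\underline{\mathscr{X}}(X,Z)$, where $\varsigma$ is the transpose of $X\boxtimes L\underline{\mathscr{X}}(X,Z)\xrightarrow{t''^L}L(X\boxtimes\underline{\mathscr{X}}(X,Z))\xrightarrow{L\mathrm{Ev}}LZ$. "$\mathbb{L}$-homomorphism" in (2) and (3) is with respect to these structures. *)

theory Defs
  imports Main
begin

section \<open>Categories, equalizers and coequalizers\<close>

text \<open>
  Hom-sets are not required to be disjoint: an arrow is always considered together with
  a stated domain and codomain.  This lets the category of algebras below reuse the arrows
  of the base category.
\<close>

record ('o, 'a) category =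
  objects :: "'o set"  ("Obj\<index>")
  arrows :: "'o \<Rightarrow> 'o \<Rightarrow> 'a set"  ("Hom\<index>")
  composition :: "'a \<Rightarrow> 'a \<Rightarrow> 'a"  (infixl "\<cdot>\<index>" 55)
  ident :: "'o \<Rightarrow> 'a"  ("\<one>\<index>")

locale category =
  fixes X :: "('o, 'a, 'm) category_scheme" (structure)
  assumes ident_in_hom: "A \<in> Obj \<Longrightarrow> \<one> A \<in> Hom A A"
    and comp_in_hom: "\<lbrakk>A \<in> Obj; B \<in> Obj; C \<in> Obj; f \<in> Hom A B; g \<in> Hom B C\<rbrakk> \<Longrightarrow> g \<cdot> f \<in> Hom A C"
    and comp_ident_right: "\<lbrakk>A \<in> Obj; B \<in> Obj; f \<in> Hom A B\<rbrakk> \<Longrightarrow> f \<cdot> \<one> A = f"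
    and comp_ident_left: "\<lbrakk>A \<in> Obj; B \<in> Obj; f \<in> Hom A B\<rbrakk> \<Longrightarrow> \<one> B \<cdot> f = f"
    and comp_assoc: "\<lbrakk>A \<in> Obj; B \<in> Obj; C \<in> Obj; D \<in> Obj; f \<in> Hom A B; g \<in> Hom B C; h \<in> Hom C D\<rbrakk>
          \<Longrightarrow> h \<cdot> g \<cdot> f = h \<cdot> (g \<cdot> f)"

context
  fixes X :: "('o, 'a, 'm) category_scheme" (structure)
begin

definition inverse_arrows :: "'o \<Rightarrow> 'o \<Rightarrow> 'a \<Rightarrow> 'a \<Rightarrow> bool" where
  "inverse_arrows A B f g \<longleftrightarrow>
     f \<in> Hom A B \<and> g \<in> Hom B A \<and> g \<cdot> f = \<one> A \<and> f \<cdot> g = \<one> B"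

definition is_iso :: "'o \<Rightarrow> 'o \<Rightarrow> 'a \<Rightarrow> bool" where
  "is_iso A B f \<longleftrightarrow> (\<exists>g. inverse_arrows A B f g)"

definition inv_arrow :: "'o \<Rightarrow> 'o \<Rightarrow> 'a \<Rightarrow> 'a" where
  "inv_arrow A B f = (THE g. inverse_arrows A B f g)"

definition is_equalizer :: "'o \<Rightarrow> 'o \<Rightarrow> 'a \<Rightarrow> 'a \<Rightarrow> 'o \<Rightarrow> 'a \<Rightarrow> bool" where
  "is_equalizer A B f g E e \<longleftrightarrow>
     E \<in> Obj \<and> e \<in> Hom E A \<and> f \<cdot> e = g \<cdot> e \<and>
     (\<forall>D\<in>Obj. \<forall>d\<in>Hom D A. f \<cdot> d = g \<cdot> d \<longrightarrow> (\<exists>!u. u \<in> Hom D E \<and> e \<cdot> u = d))"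

definition has_equalizer :: "'o \<Rightarrow> 'o \<Rightarrow> 'a \<Rightarrow> 'a \<Rightarrow> bool" where
  "has_equalizer A B f g \<longleftrightarrow>
     f \<in> Hom A B \<and> g \<in> Hom A B \<and> (\<exists>E e. is_equalizer A B f g E e)"

definition is_coequalizer :: "'o \<Rightarrow> 'o \<Rightarrow> 'a \<Rightarrow> 'a \<Rightarrow> 'o \<Rightarrow> 'a \<Rightarrow> bool" where
  "is_coequalizer A B f g Q q \<longleftrightarrow>
     Q \<in> Obj \<and> q \<in> Hom B Q \<and> q \<cdot> f = q \<cdot> g \<and>
     (\<forall>D\<in>Obj. \<forall>d\<in>Hom B D. d \<cdot> f = d \<cdot> g \<longrightarrow> (\<exists>!u. u \<in> Hom Q D \<and> u \<cdot> q = d))"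

definition has_coequalizer :: "'o \<Rightarrow> 'o \<Rightarrow> 'a \<Rightarrow> 'a \<Rightarrow> bool" where
  "has_coequalizer A B f g \<longleftrightarrow>
     f \<in> Hom A B \<and> g \<in> Hom A B \<and> (\<exists>Q q. is_coequalizer A B f g Q q)"

end


section \<open>Symmetric monoidal closed categories\<close>

text \<open>
  The internal hom \<open>A \<multimap> B\<close> is right adjoint to \<open>A \<boxtimes> -\<close>, with counit
  \<open>Ev A B : A \<boxtimes> (A \<multimap> B) \<rightarrow> B\<close>.  The operation \<open>\<boxtimes>\<close> is the tensor product
  of objects, \<open>\<boxtimes>\<^sub>1\<close> that of arrows.
\<close>

record ('o, 'a) monoidal_closed_category = "('o, 'a) category" +
  tensor_obj :: "'o \<Rightarrow> 'o \<Rightarrow> 'o"  (infixr "\<boxtimes>\<index>" 65)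
  tensor_arr :: "'a \<Rightarrow> 'a \<Rightarrow> 'a"  (infixr "\<boxtimes>\<^sub>1\<index>" 65)
  unit_obj :: 'o  ("\<I>\<index>")
  assoc :: "'o \<Rightarrow> 'o \<Rightarrow> 'o \<Rightarrow> 'a"  ("\<a>\<index>")
  lunit :: "'o \<Rightarrow> 'a"  ("\<l>\<index>")
  runit :: "'o \<Rightarrow> 'a"  ("\<r>\<index>")
  symm :: "'o \<Rightarrow> 'o \<Rightarrow> 'a"  ("\<s>\<index>")
  ihom :: "'o \<Rightarrow> 'o \<Rightarrow> 'o"  (infixr "\<multimap>\<index>" 60)
  evaluation :: "'o \<Rightarrow> 'o \<Rightarrow> 'a"  ("Ev\<index>")

locale symmetric_monoidal_closed_category = category X
  for X :: "('o, 'a, 'm) monoidal_closed_category_scheme" (structure) +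
  assumes unit_obj: "\<I> \<in> Obj"
    and tensor_obj: "\<lbrakk>A \<in> Obj; B \<in> Obj\<rbrakk> \<Longrightarrow> A \<boxtimes> B \<in> Obj"
    and tensor_in_hom:
      "\<lbrakk>A \<in> Obj; B \<in> Obj; A' \<in> Obj; B' \<in> Obj; f \<in> Hom A B; f' \<in> Hom A' B'\<rbrakk>
        \<Longrightarrow> f \<boxtimes>\<^sub>1 f' \<in> Hom (A \<boxtimes> A') (B \<boxtimes> B')"
    and tensor_ident: "\<lbrakk>A \<in> Obj; B \<in> Obj\<rbrakk> \<Longrightarrow> \<one> A \<boxtimes>\<^sub>1 \<one> B = \<one> (A \<boxtimes> B)"
    and tensor_comp:
      "\<lbrakk>A \<in> Obj; B \<in> Obj; C \<in> Obj; A' \<in> Obj; B' \<in> Obj; C' \<in> Obj;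
        f \<in> Hom A B; g \<in> Hom B C; f' \<in> Hom A' B'; g' \<in> Hom B' C'\<rbrakk>
        \<Longrightarrow> (g \<cdot> f) \<boxtimes>\<^sub>1 (g' \<cdot> f') = (g \<boxtimes>\<^sub>1 g') \<cdot> (f \<boxtimes>\<^sub>1 f')"
    and assoc_iso:
      "\<lbrakk>A \<in> Obj; B \<in> Obj; C \<in> Obj\<rbrakk>
        \<Longrightarrow> is_iso X ((A \<boxtimes> B) \<boxtimes> C) (A \<boxtimes> (B \<boxtimes> C)) (\<a> A B C)"
    and lunit_iso: "A \<in> Obj \<Longrightarrow> is_iso X (\<I> \<boxtimes> A) A (\<l> A)"
    and runit_iso: "A \<in> Obj \<Longrightarrow> is_iso X (A \<boxtimes> \<I>) A (\<r> A)"
    and symm_in_hom: "\<lbrakk>A \<in> Obj; B \<in> Obj\<rbrakk> \<Longrightarrow> \<s> A B \<in> Hom (A \<boxtimes> B) (B \<boxtimes> A)"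
    and assoc_natural:
      "\<lbrakk>A \<in> Obj; B \<in> Obj; C \<in> Obj; A' \<in> Obj; B' \<in> Obj; C' \<in> Obj;
        f \<in> Hom A A'; g \<in> Hom B B'; h \<in> Hom C C'\<rbrakk>
        \<Longrightarrow> \<a> A' B' C' \<cdot> ((f \<boxtimes>\<^sub>1 g) \<boxtimes>\<^sub>1 h) = (f \<boxtimes>\<^sub>1 (g \<boxtimes>\<^sub>1 h)) \<cdot> \<a> A B C"
    and lunit_natural:
      "\<lbrakk>A \<in> Obj; B \<in> Obj; f \<in> Hom A B\<rbrakk> \<Longrightarrow> \<l> B \<cdot> (\<one> \<I> \<boxtimes>\<^sub>1 f) = f \<cdot> \<l> A"
    and runit_natural:
      "\<lbrakk>A \<in> Obj; B \<in> Obj; f \<in> Hom A B\<rbrakk> \<Longrightarrow> \<r> B \<cdot> (f \<boxtimes>\<^sub>1 \<one> \<I>) = f \<cdot> \<r> A"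
    and symm_natural:
      "\<lbrakk>A \<in> Obj; B \<in> Obj; A' \<in> Obj; B' \<in> Obj; f \<in> Hom A A'; g \<in> Hom B B'\<rbrakk>
        \<Longrightarrow> \<s> A' B' \<cdot> (f \<boxtimes>\<^sub>1 g) = (g \<boxtimes>\<^sub>1 f) \<cdot> \<s> A B"
    and pentagon:
      "\<lbrakk>A \<in> Obj; B \<in> Obj; C \<in> Obj; D \<in> Obj\<rbrakk>
        \<Longrightarrow> \<a> A B (C \<boxtimes> D) \<cdot> \<a> (A \<boxtimes> B) C D
          = (\<one> A \<boxtimes>\<^sub>1 \<a> B C D) \<cdot> \<a> A (B \<boxtimes> C) D \<cdot> (\<a> A B C \<boxtimes>\<^sub>1 \<one> D)"
    and triangle:
      "\<lbrakk>A \<in> Obj; B \<in> Obj\<rbrakk> \<Longrightarrow> (\<one> A \<boxtimes>\<^sub>1 \<l> B) \<cdot> \<a> A \<I> B = \<r> A \<boxtimes>\<^sub>1 \<one> B"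
    and symm_involution: "\<lbrakk>A \<in> Obj; B \<in> Obj\<rbrakk> \<Longrightarrow> \<s> B A \<cdot> \<s> A B = \<one> (A \<boxtimes> B)"
    and hexagon:
      "\<lbrakk>A \<in> Obj; B \<in> Obj; C \<in> Obj\<rbrakk>
        \<Longrightarrow> \<a> B C A \<cdot> \<s> A (B \<boxtimes> C) \<cdot> \<a> A B C
          = (\<one> B \<boxtimes>\<^sub>1 \<s> A C) \<cdot> \<a> B A C \<cdot> (\<s> A B \<boxtimes>\<^sub>1 \<one> C)"
    and ihom_obj: "\<lbrakk>A \<in> Obj; B \<in> Obj\<rbrakk> \<Longrightarrow> A \<multimap> B \<in> Obj"
    and ev_in_hom: "\<lbrakk>A \<in> Obj; B \<in> Obj\<rbrakk> \<Longrightarrow> Ev A B \<in> Hom (A \<boxtimes> (A \<multimap> B)) B"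
    and ev_universal:
      "\<lbrakk>A \<in> Obj; B \<in> Obj; C \<in> Obj; f \<in> Hom (A \<boxtimes> C) B\<rbrakk>
        \<Longrightarrow> \<exists>!g. g \<in> Hom C (A \<multimap> B) \<and> Ev A B \<cdot> (\<one> A \<boxtimes>\<^sub>1 g) = f"


section \<open>Functors, natural transformations and monads enriched in the base\<close>

text \<open>
  Here \<open>X\<close> is regarded as a category enriched in itself, with hom-objects \<open>A \<multimap> B\<close>.
  In an enriched endofunctor, \<open>on_hom T A B\<close> is an arrow \<open>A \<multimap> B \<rightarrow> T A \<multimap> T B\<close>.
\<close>

record ('o, 'a) enriched_functor =
  on_obj :: "'o \<Rightarrow> 'o"
  on_hom :: "'o \<Rightarrow> 'o \<Rightarrow> 'a"

record ('o, 'a) enriched_monad = "('o, 'a) enriched_functor" +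
  unit_of :: "'o \<Rightarrow> 'a"
  mult_of :: "'o \<Rightarrow> 'a"

context
  fixes X :: "('o, 'a, 'm) monoidal_closed_category_scheme" (structure)
begin

text \<open>The transpose \<open>C \<rightarrow> (A \<multimap> B)\<close> of \<open>f : A \<boxtimes> C \<rightarrow> B\<close>, and conversely.\<close>

definition adj_transpose :: "'o \<Rightarrow> 'o \<Rightarrow> 'o \<Rightarrow> 'a \<Rightarrow> 'a" where
  "adj_transpose A C B f = (THE g. g \<in> Hom C (A \<multimap> B) \<and> Ev A B \<cdot> (\<one> A \<boxtimes>\<^sub>1 g) = f)"

definition adj_untranspose :: "'o \<Rightarrow> 'o \<Rightarrow> 'a \<Rightarrow> 'a" where
  "adj_untranspose A B g = Ev A B \<cdot> (\<one> A \<boxtimes>\<^sub>1 g)"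

text \<open>\<open>ihom_post A B C f : (A \<multimap> B) \<rightarrow> (A \<multimap> C)\<close> for \<open>f : B \<rightarrow> C\<close>, and
  \<open>ihom_pre A B C f : (B \<multimap> C) \<rightarrow> (A \<multimap> C)\<close> for \<open>f : A \<rightarrow> B\<close>.\<close>

definition ihom_post :: "'o \<Rightarrow> 'o \<Rightarrow> 'o \<Rightarrow> 'a \<Rightarrow> 'a" where
  "ihom_post A B C f = adj_transpose A (A \<multimap> B) C (f \<cdot> Ev A B)"

definition ihom_pre :: "'o \<Rightarrow> 'o \<Rightarrow> 'o \<Rightarrow> 'a \<Rightarrow> 'a" where
  "ihom_pre A B C f = adj_transpose A (B \<multimap> C) C (Ev B C \<cdot> (f \<boxtimes>\<^sub>1 \<one> (B \<multimap> C)))"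

text \<open>The element \<open>\<I> \<rightarrow> (A \<multimap> B)\<close> of the hom-object corresponding to an arrow
  \<open>f : A \<rightarrow> B\<close>, and the arrow corresponding to such an element.\<close>

definition name_of :: "'o \<Rightarrow> 'o \<Rightarrow> 'a \<Rightarrow> 'a" where
  "name_of A B f = adj_transpose A \<I> B (f \<cdot> \<r> A)"

definition arrow_of :: "'o \<Rightarrow> 'o \<Rightarrow> 'a \<Rightarrow> 'a" where
  "arrow_of A B u = adj_untranspose A B u \<cdot> inv_arrow X (A \<boxtimes> \<I>) A (\<r> A)"

text \<open>Identities and composition \<open>(B \<multimap> C) \<boxtimes> (A \<multimap> B) \<rightarrow> (A \<multimap> C)\<close> of the
  self-enrichment.\<close>

definition self_ident :: "'o \<Rightarrow> 'a" where
  "self_ident A = name_of A A (\<one> A)"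

definition self_comp :: "'o \<Rightarrow> 'o \<Rightarrow> 'o \<Rightarrow> 'a" where
  "self_comp A B C =
     adj_transpose A ((B \<multimap> C) \<boxtimes> (A \<multimap> B)) C
       (Ev B C \<cdot> (Ev A B \<boxtimes>\<^sub>1 \<one> (B \<multimap> C))
        \<cdot> inv_arrow X ((A \<boxtimes> (A \<multimap> B)) \<boxtimes> (B \<multimap> C)) (A \<boxtimes> ((A \<multimap> B) \<boxtimes> (B \<multimap> C)))
            (\<a> A (A \<multimap> B) (B \<multimap> C))
        \<cdot> (\<one> A \<boxtimes>\<^sub>1 \<s> (B \<multimap> C) (A \<multimap> B)))"

definition is_enriched_functor :: "('o, 'a, 'n) enriched_functor_scheme \<Rightarrow> bool" where
  "is_enriched_functor T \<longleftrightarrow>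
     (\<forall>A\<in>Obj. on_obj T A \<in> Obj) \<and>
     (\<forall>A\<in>Obj. \<forall>B\<in>Obj. on_hom T A B \<in> Hom (A \<multimap> B) (on_obj T A \<multimap> on_obj T B)) \<and>
     (\<forall>A\<in>Obj. on_hom T A A \<cdot> self_ident A = self_ident (on_obj T A)) \<and>
     (\<forall>A\<in>Obj. \<forall>B\<in>Obj. \<forall>C\<in>Obj.
        on_hom T A C \<cdot> self_comp A B C
        = self_comp (on_obj T A) (on_obj T B) (on_obj T C)
          \<cdot> (on_hom T B C \<boxtimes>\<^sub>1 on_hom T A B))"

text \<open>The action \<open>T f : T A \<rightarrow> T B\<close> on \<open>f : A \<rightarrow> B\<close> of the underlying ordinary functor.\<close>

definition on_arr :: "('o, 'a, 'n) enriched_functor_scheme \<Rightarrow> 'o \<Rightarrow> 'o \<Rightarrow> 'a \<Rightarrow> 'a" where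
  "on_arr T A B f = arrow_of (on_obj T A) (on_obj T B) (on_hom T A B \<cdot> name_of A B f)"

definition identity_functor :: "('o, 'a) enriched_functor" where
  "identity_functor = \<lparr>on_obj = (\<lambda>A. A), on_hom = (\<lambda>A B. \<one> (A \<multimap> B))\<rparr>"

definition composite_functor ::
    "('o, 'a, 'n) enriched_functor_scheme \<Rightarrow> ('o, 'a, 'k) enriched_functor_scheme
      \<Rightarrow> ('o, 'a) enriched_functor" where
  "composite_functor S T =
     \<lparr>on_obj = (\<lambda>A. on_obj S (on_obj T A)),
      on_hom = (\<lambda>A B. on_hom S (on_obj T A) (on_obj T B) \<cdot> on_hom T A B)\<rparr>"

text \<open>Enriched naturality of a family of arrows \<open>\<theta> A : S A \<rightarrow> T A\<close>: the two arrows
  \<open>(A \<multimap> B) \<rightarrow> (S A \<multimap> T B)\<close> agree.\<close>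

definition enriched_natural ::
    "('o, 'a, 'n) enriched_functor_scheme \<Rightarrow> ('o, 'a, 'k) enriched_functor_scheme
      \<Rightarrow> ('o \<Rightarrow> 'a) \<Rightarrow> bool" where
  "enriched_natural S T \<theta> \<longleftrightarrow>
     (\<forall>A\<in>Obj. \<theta> A \<in> Hom (on_obj S A) (on_obj T A)) \<and>
     (\<forall>A\<in>Obj. \<forall>B\<in>Obj.
        ihom_post (on_obj S A) (on_obj S B) (on_obj T B) (\<theta> B) \<cdot> on_hom S A B
        = ihom_pre (on_obj S A) (on_obj T A) (on_obj T B) (\<theta> A) \<cdot> on_hom T A B)"

definition is_enriched_monad :: "('o, 'a, 'n) enriched_monad_scheme \<Rightarrow> bool" where
  "is_enriched_monad T \<longleftrightarrow>
     is_enriched_functor T \<and>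
     enriched_natural identity_functor T (unit_of T) \<and>
     enriched_natural (composite_functor T T) T (mult_of T) \<and>
     (\<forall>A\<in>Obj. mult_of T A \<cdot> on_arr T A (on_obj T A) (unit_of T A) = \<one> (on_obj T A)) \<and>
     (\<forall>A\<in>Obj. mult_of T A \<cdot> unit_of T (on_obj T A) = \<one> (on_obj T A)) \<and>
     (\<forall>A\<in>Obj. mult_of T A \<cdot> on_arr T (on_obj T (on_obj T A)) (on_obj T A) (mult_of T A)
              = mult_of T A \<cdot> mult_of T (on_obj T A))"

text \<open>Since \<open>\<Delta>\<close> is natural, the horizontal composite \<open>\<Delta>\<Delta>\<close> may be written as
  \<open>\<Delta>M \<cdot> L\<Delta>\<close>.\<close>

definition is_monad_morphism ::
    "('o, 'a, 'n) enriched_monad_scheme \<Rightarrow> ('o, 'a, 'k) enriched_monad_scheme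
      \<Rightarrow> ('o \<Rightarrow> 'a) \<Rightarrow> bool" where
  "is_monad_morphism L M \<Delta> \<longleftrightarrow>
     enriched_natural L M \<Delta> \<and>
     (\<forall>A\<in>Obj. \<Delta> A \<cdot> unit_of L A = unit_of M A) \<and>
     (\<forall>A\<in>Obj. \<Delta> A \<cdot> mult_of L A
        = mult_of M A \<cdot> \<Delta> (on_obj M A) \<cdot> on_arr L (on_obj L A) (on_obj M A) (\<Delta> A))"


section \<open>Algebras\<close>

definition is_algebra :: "('o, 'a, 'n) enriched_monad_scheme \<Rightarrow> 'o \<Rightarrow> 'a \<Rightarrow> bool" where
  "is_algebra T A a \<longleftrightarrow>
     A \<in> Obj \<and> a \<in> Hom (on_obj T A) A \<and>
     a \<cdot> unit_of T A = \<one> A \<and>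
     a \<cdot> mult_of T A = a \<cdot> on_arr T (on_obj T A) A a"

definition is_algebra_hom ::
    "('o, 'a, 'n) enriched_monad_scheme \<Rightarrow> 'o \<times> 'a \<Rightarrow> 'o \<times> 'a \<Rightarrow> 'a \<Rightarrow> bool" where
  "is_algebra_hom T = (\<lambda>(A, a) (B, b) f. f \<in> Hom A B \<and> f \<cdot> a = b \<cdot> on_arr T A B f)"

definition algebra_category ::
    "('o, 'a, 'n) enriched_monad_scheme \<Rightarrow> ('o \<times> 'a, 'a) category" where
  "algebra_category T =
     \<lparr>objects = {(A, a). is_algebra T A a},
      arrows = (\<lambda>P Q. {f. is_algebra_hom T P Q f}),
      composition = composition X,
      ident = (\<lambda>(A, a). \<one> A)\<rparr>"


section \<open>Tensorial strengths and commutativity\<close>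

text \<open>\<open>strength_left T A B : T A \<boxtimes> B \<rightarrow> T (A \<boxtimes> B)\<close> and
  \<open>strength_right T A B : A \<boxtimes> T B \<rightarrow> T (A \<boxtimes> B)\<close> are the arrows \<open>t'\<close> and \<open>t''\<close>.
  For the second one the transposition is on the right-hand tensor factor, whence the
  occurrences of the symmetry.\<close>

definition strength_left :: "('o, 'a, 'n) enriched_functor_scheme \<Rightarrow> 'o \<Rightarrow> 'o \<Rightarrow> 'a" where
  "strength_left T A B =
     adj_untranspose (on_obj T A) (on_obj T (A \<boxtimes> B))
       (on_hom T A (A \<boxtimes> B) \<cdot> adj_transpose A B (A \<boxtimes> B) (\<one> (A \<boxtimes> B)))"

definition strength_right :: "('o, 'a, 'n) enriched_functor_scheme \<Rightarrow> 'o \<Rightarrow> 'o \<Rightarrow> 'a" where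
  "strength_right T A B =
     adj_untranspose (on_obj T B) (on_obj T (A \<boxtimes> B))
       (on_hom T B (A \<boxtimes> B) \<cdot> adj_transpose B A (A \<boxtimes> B) (\<s> B A))
     \<cdot> \<s> A (on_obj T B)"

definition monad_tensor :: "('o, 'a, 'n) enriched_monad_scheme \<Rightarrow> 'o \<Rightarrow> 'o \<Rightarrow> 'a" where
  "monad_tensor T A B =
     mult_of T (A \<boxtimes> B)
     \<cdot> on_arr T (on_obj T A \<boxtimes> B) (on_obj T (A \<boxtimes> B)) (strength_left T A B)
     \<cdot> strength_right T (on_obj T A) B"

definition monad_tensor' :: "('o, 'a, 'n) enriched_monad_scheme \<Rightarrow> 'o \<Rightarrow> 'o \<Rightarrow> 'a" where
  "monad_tensor' T A B =
     mult_of T (A \<boxtimes> B)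
     \<cdot> on_arr T (A \<boxtimes> on_obj T B) (on_obj T (A \<boxtimes> B)) (strength_right T A B)
     \<cdot> strength_left T A (on_obj T B)"

definition commutative_monad :: "('o, 'a, 'n) enriched_monad_scheme \<Rightarrow> bool" where
  "commutative_monad T \<longleftrightarrow>
     is_enriched_monad T \<and> (\<forall>A\<in>Obj. \<forall>B\<in>Obj. monad_tensor T A B = monad_tensor' T A B)"

definition has_algebra_tensor_products :: "('o, 'a, 'n) enriched_monad_scheme \<Rightarrow> bool" where
  "has_algebra_tensor_products T \<longleftrightarrow>
     (\<forall>A a B b. is_algebra T A a \<longrightarrow> is_algebra T B b \<longrightarrow>
        has_coequalizer (algebra_category T)
          (on_obj T (on_obj T A \<boxtimes> on_obj T B), mult_of T (on_obj T A \<boxtimes> on_obj T B))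
          (on_obj T (A \<boxtimes> B), mult_of T (A \<boxtimes> B))
          (mult_of T (A \<boxtimes> B)
           \<cdot> on_arr T (on_obj T A \<boxtimes> on_obj T B) (on_obj T (A \<boxtimes> B)) (monad_tensor T A B))
          (on_arr T (on_obj T A \<boxtimes> on_obj T B) (A \<boxtimes> B) (a \<boxtimes>\<^sub>1 b)))"

definition enriched_eilenberg_moore_exists :: "('o, 'a, 'n) enriched_monad_scheme \<Rightarrow> bool" where
  "enriched_eilenberg_moore_exists T \<longleftrightarrow>
     (\<forall>A a B b. is_algebra T A a \<longrightarrow> is_algebra T B b \<longrightarrow>
        has_equalizer X (A \<multimap> B) (on_obj T A \<multimap> B)
          (ihom_post (on_obj T A) (on_obj T B) B b \<cdot> on_hom T A B)
          (ihom_pre (on_obj T A) A B a))"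


section \<open>Relative commutativity and extenders\<close>

definition relative_tensor ::
    "('o, 'a, 'n) enriched_monad_scheme \<Rightarrow> ('o, 'a, 'k) enriched_monad_scheme
      \<Rightarrow> ('o \<Rightarrow> 'a) \<Rightarrow> 'o \<Rightarrow> 'o \<Rightarrow> 'a" where
  "relative_tensor L M \<Delta> A B =
     mult_of M (A \<boxtimes> B)
     \<cdot> \<Delta> (on_obj M (A \<boxtimes> B))
     \<cdot> on_arr L (on_obj M A \<boxtimes> B) (on_obj M (A \<boxtimes> B)) (strength_left M A B)
     \<cdot> strength_right L (on_obj M A) B"

definition relative_tensor' ::
    "('o, 'a, 'n) enriched_monad_scheme \<Rightarrow> ('o, 'a, 'k) enriched_monad_scheme
      \<Rightarrow> ('o \<Rightarrow> 'a) \<Rightarrow> 'o \<Rightarrow> 'o \<Rightarrow> 'a" where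
  "relative_tensor' L M \<Delta> A B =
     mult_of M (A \<boxtimes> B)
     \<cdot> on_arr M (on_obj L (A \<boxtimes> B)) (on_obj M (A \<boxtimes> B)) (\<Delta> (A \<boxtimes> B))
     \<cdot> on_arr M (A \<boxtimes> on_obj L B) (on_obj L (A \<boxtimes> B)) (strength_right L A B)
     \<cdot> strength_left M A (on_obj L B)"

definition relatively_commutative ::
    "('o, 'a, 'n) enriched_monad_scheme \<Rightarrow> ('o, 'a, 'k) enriched_monad_scheme
      \<Rightarrow> ('o \<Rightarrow> 'a) \<Rightarrow> bool" where
  "relatively_commutative L M \<Delta> \<longleftrightarrow>
     (\<forall>A\<in>Obj. \<forall>B\<in>Obj. relative_tensor L M \<Delta> A B = relative_tensor' L M \<Delta> A B)"

definition extender ::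
    "('o, 'a, 'n) enriched_monad_scheme \<Rightarrow> 'o \<Rightarrow> 'o \<Rightarrow> 'a \<Rightarrow> 'a" where
  "extender M A Z a =
     ihom_post (on_obj M A) (on_obj M Z) Z a \<cdot> on_hom M A Z"

text \<open>The pointwise algebra structure \<open>T (A \<multimap> Z) \<rightarrow> (A \<multimap> Z)\<close> for a \<open>T\<close>-algebra
  \<open>(Z, b)\<close>; \<open>cotensor_strength T A Z\<close> is the arrow \<open>\<varsigma> : T (A \<multimap> Z) \<rightarrow> (A \<multimap> T Z)\<close>.\<close>

definition cotensor_strength ::
    "('o, 'a, 'n) enriched_functor_scheme \<Rightarrow> 'o \<Rightarrow> 'o \<Rightarrow> 'a" where
  "cotensor_strength T A Z =
     adj_transpose A (on_obj T (A \<multimap> Z)) (on_obj T Z)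
       (on_arr T (A \<boxtimes> (A \<multimap> Z)) Z (Ev A Z) \<cdot> strength_right T A (A \<multimap> Z))"

definition pointwise_algebra ::
    "('o, 'a, 'n) enriched_monad_scheme \<Rightarrow> 'o \<Rightarrow> 'o \<times> 'a \<Rightarrow> 'o \<times> 'a" where
  "pointwise_algebra T A =
     (\<lambda>(Z, b). (A \<multimap> Z, ihom_post A (on_obj T Z) Z b \<cdot> cotensor_strength T A Z))"

definition restricted_algebra :: "('o \<Rightarrow> 'a) \<Rightarrow> 'o \<times> 'a \<Rightarrow> 'o \<times> 'a" where
  "restricted_algebra \<Delta> = (\<lambda>(Z, a). (Z, a \<cdot> \<Delta> Z))"

definition extender_is_hom ::
    "('o, 'a, 'n) enriched_monad_scheme \<Rightarrow> ('o, 'a, 'k) enriched_monad_scheme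
      \<Rightarrow> ('o \<Rightarrow> 'a) \<Rightarrow> 'o \<Rightarrow> 'o \<Rightarrow> 'a \<Rightarrow> bool" where
  "extender_is_hom L M \<Delta> A Z a \<longleftrightarrow>
     is_algebra_hom L
       (pointwise_algebra L A (restricted_algebra \<Delta> (Z, a)))
       (pointwise_algebra L (on_obj M A) (restricted_algebra \<Delta> (Z, a)))
       (extender M A Z a)"

end

end

theory Submission
  imports Defs
begin

text \<open>
  Transposing the homomorphism condition for the extender of an \<open>M\<close>-algebra \<open>(Z, a)\<close> gives
  two arrows \<open>M A \<boxtimes> L (A \<multimap> Z) \<rightarrow> Z\<close>.  By naturality of the strengths, of \<open>\<Delta>\<close> and of the
  multiplication, together with the associativity law of \<open>a\<close>, they are the two relative tensors
  at \<open>(A, A \<multimap> Z)\<close> followed by \<open>a \<cdot> M Ev\<close>.  Hence relative commutativity makes every extender a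
  homomorphism.  Conversely, take \<open>(Z, a)\<close> free on \<open>A \<boxtimes> B\<close> and precompose with the transpose
  \<open>B \<rightarrow> (A \<multimap> M (A \<boxtimes> B))\<close> of the unit: naturality in the second argument and the unit law
  cancel \<open>a \<cdot> M Ev\<close> and leave the relative tensors at \<open>(A, B)\<close>.
\<close>

section \<open>Arrows with source and target\<close>

text \<open>Bundling an arrow with its source and target makes these two functions of the arrow, so
  that the side conditions of the equations below contain no unknowns and are dischargeable by
  rewriting.\<close>

datatype ('o, 'a) typed_arrow = Arrow (src: 'o) (tgt: 'o) (raw: 'a)

text \<open>\<open>inv_arrow\<close> is a definite description, so it is usable only once two-sided
  inverses are known to be unique:
  \<open>h = h \<cdot> (f \<cdot> g) = (h \<cdot> f) \<cdot> g = g\<close>.\<close>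

lemma (in category) inverse_arrows_inv_arrow:
  assumes "A \<in> Obj" "B \<in> Obj" "is_iso X A B f"
  shows "inverse_arrows X A B f (inv_arrow X A B f)"
proof -
  from assms(3) obtain g where g: "inverse_arrows X A B f g"
    unfolding is_iso_def ..
  have "h = g" if h: "inverse_arrows X A B f h" for h
  proof -
    have "h = h \<cdot> (f \<cdot> g)"
      using g h assms(1,2) by (simp add: inverse_arrows_def comp_ident_right)
    also have "\<dots> = h \<cdot> f \<cdot> g"
      using g h assms(1,2)
        comp_assoc[of B A B A g f h]
      by (simp add: inverse_arrows_def)
    also have "\<dots> = g"
      using g h assms(1,2) by (simp add: inverse_arrows_def comp_ident_left)
    finally show ?thesis .
  qed
  with g show ?thesis
    unfolding inv_arrow_def by (metis theI)
qed

context symmetric_monoidal_closed_category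
begin

section \<open>Structure maps of the base as typed arrows\<close>

text \<open>In proofs that unfold \<open>valid_def\<close> the rules \<open>valid_obj\<close> must be removed from the simpset,
  since together they do not terminate.\<close>

definition valid :: "('o, 'a) typed_arrow \<Rightarrow> bool" where
  "valid f \<longleftrightarrow> src f \<in> Obj \<and> tgt f \<in> Obj \<and> raw f \<in> Hom (src f) (tgt f)"

text \<open>The operation is total; composability enters only as a side condition of the lemmas. It
  associates to the right, the normal form of \<open>comp_arr_assoc\<close>, whereas
  \<open>\<cdot>\<close> associates to the left.\<close>

definition comp_arr :: "('o, 'a) typed_arrow \<Rightarrow> ('o, 'a) typed_arrow \<Rightarrow> ('o, 'a) typed_arrow"
    (infixr "\<odot>" 55) where
  "g \<odot> f = Arrow (src f) (tgt g) (raw g \<cdot> raw f)"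

definition tensor :: "('o, 'a) typed_arrow \<Rightarrow> ('o, 'a) typed_arrow \<Rightarrow> ('o, 'a) typed_arrow"
    (infixr "\<otimes>" 65) where
  "f \<otimes> g = Arrow (src f \<boxtimes> src g) (tgt f \<boxtimes> tgt g) (raw f \<boxtimes>\<^sub>1 raw g)"

definition Id :: "'o \<Rightarrow> ('o, 'a) typed_arrow" where
  "Id A = Arrow A A (\<one> A)"

definition As :: "'o \<Rightarrow> 'o \<Rightarrow> 'o \<Rightarrow> ('o, 'a) typed_arrow" where
  "As A B C = Arrow ((A \<boxtimes> B) \<boxtimes> C) (A \<boxtimes> (B \<boxtimes> C)) (\<a> A B C)"

definition As_inv :: "'o \<Rightarrow> 'o \<Rightarrow> 'o \<Rightarrow> ('o, 'a) typed_arrow" where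
  "As_inv A B C = Arrow (A \<boxtimes> (B \<boxtimes> C)) ((A \<boxtimes> B) \<boxtimes> C)
     (inv_arrow X ((A \<boxtimes> B) \<boxtimes> C) (A \<boxtimes> (B \<boxtimes> C)) (\<a> A B C))"

definition Ru :: "'o \<Rightarrow> ('o, 'a) typed_arrow" where
  "Ru A = Arrow (A \<boxtimes> \<I>) A (\<r> A)"

definition Ru_inv :: "'o \<Rightarrow> ('o, 'a) typed_arrow" where
  "Ru_inv A = Arrow A (A \<boxtimes> \<I>) (inv_arrow X (A \<boxtimes> \<I>) A (\<r> A))"

definition Lu :: "'o \<Rightarrow> ('o, 'a) typed_arrow" where
  "Lu A = Arrow (\<I> \<boxtimes> A) A (\<l> A)"

definition Lu_inv :: "'o \<Rightarrow> ('o, 'a) typed_arrow" where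
  "Lu_inv A = Arrow A (\<I> \<boxtimes> A) (inv_arrow X (\<I> \<boxtimes> A) A (\<l> A))"

definition Sy :: "'o \<Rightarrow> 'o \<Rightarrow> ('o, 'a) typed_arrow" where
  "Sy A B = Arrow (A \<boxtimes> B) (B \<boxtimes> A) (\<s> A B)"

definition ev :: "'o \<Rightarrow> 'o \<Rightarrow> ('o, 'a) typed_arrow" where
  "ev A B = Arrow (A \<boxtimes> (A \<multimap> B)) B (Ev A B)"

text \<open>The factors \<open>A\<close> and \<open>C\<close> are arguments because they cannot be
  recovered from the object \<open>A \<boxtimes> C\<close>, the intended source of
  \<open>f\<close>.\<close>

definition cur :: "'o \<Rightarrow> 'o \<Rightarrow> ('o, 'a) typed_arrow \<Rightarrow> ('o, 'a) typed_arrow" where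
  "cur A C f = Arrow C (A \<multimap> tgt f) (adj_transpose X A C (tgt f) (raw f))"

lemmas arrow_defs = comp_arr_def tensor_def Id_def As_def As_inv_def Ru_def Ru_inv_def
  Lu_def Lu_inv_def Sy_def ev_def cur_def

lemma src_tgt [simp]:
  "src (g \<odot> f) = src f" "tgt (g \<odot> f) = tgt g"
  "src (f \<otimes> g) = src f \<boxtimes> src g" "tgt (f \<otimes> g) = tgt f \<boxtimes> tgt g"
  "src (Id A) = A" "tgt (Id A) = A"
  "src (As A B C) = (A \<boxtimes> B) \<boxtimes> C" "tgt (As A B C) = A \<boxtimes> (B \<boxtimes> C)"
  "src (As_inv A B C) = A \<boxtimes> (B \<boxtimes> C)" "tgt (As_inv A B C) = (A \<boxtimes> B) \<boxtimes> C"
  "src (Ru A) = A \<boxtimes> \<I>" "tgt (Ru A) = A"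
  "src (Ru_inv A) = A" "tgt (Ru_inv A) = A \<boxtimes> \<I>"
  "src (Lu A) = \<I> \<boxtimes> A" "tgt (Lu A) = A"
  "src (Lu_inv A) = A" "tgt (Lu_inv A) = \<I> \<boxtimes> A"
  "src (Sy A B) = A \<boxtimes> B" "tgt (Sy A B) = B \<boxtimes> A"
  "src (ev A B) = A \<boxtimes> (A \<multimap> B)" "tgt (ev A B) = B"
  "src (cur A C f) = C" "tgt (cur A C f) = A \<multimap> tgt f"
  by (simp_all add: arrow_defs)

lemma arrow_eqI:
  assumes "src f = src g" "tgt f = tgt g" "raw f = raw g"
  shows "f = g"
  using assms by (simp add: typed_arrow.expand)

lemma obj_simps [simp]:
  "\<I> \<in> Obj"
  "\<lbrakk>A \<in> Obj; B \<in> Obj\<rbrakk> \<Longrightarrow> A \<boxtimes> B \<in> Obj"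
  "\<lbrakk>A \<in> Obj; B \<in> Obj\<rbrakk> \<Longrightarrow> A \<multimap> B \<in> Obj"
  by (simp_all add: unit_obj tensor_obj ihom_obj)

lemma valid_obj [simp]:
  "valid f \<Longrightarrow> src f \<in> Obj" "valid f \<Longrightarrow> tgt f \<in> Obj"
  by (simp_all only: valid_def)

lemma adj_transpose_props:
  assumes "A \<in> Obj" "B \<in> Obj" "C \<in> Obj" "f \<in> Hom (A \<boxtimes> C) B"
  shows "adj_transpose X A C B f \<in> Hom C (A \<multimap> B)"
    and "Ev A B \<cdot> (\<one> A \<boxtimes>\<^sub>1 adj_transpose X A C B f) = f"
  using theI'[OF ev_universal[OF assms]] unfolding adj_transpose_def by blast+

lemma inv_arrow_props:
  assumes "A \<in> Obj" "B \<in> Obj" "C \<in> Obj"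
  shows "inverse_arrows X ((A \<boxtimes> B) \<boxtimes> C) (A \<boxtimes> (B \<boxtimes> C)) (\<a> A B C)
      (inv_arrow X ((A \<boxtimes> B) \<boxtimes> C) (A \<boxtimes> (B \<boxtimes> C)) (\<a> A B C))"
    and "inverse_arrows X (A \<boxtimes> \<I>) A (\<r> A) (inv_arrow X (A \<boxtimes> \<I>) A (\<r> A))"
    and "inverse_arrows X (\<I> \<boxtimes> A) A (\<l> A) (inv_arrow X (\<I> \<boxtimes> A) A (\<l> A))"
  using assms by (simp_all add: inverse_arrows_inv_arrow assoc_iso runit_iso lunit_iso)

lemma valid_simps [simp]:
  "\<lbrakk>valid g; valid f; src g = tgt f\<rbrakk> \<Longrightarrow> valid (g \<odot> f)"
  "\<lbrakk>valid f; valid g\<rbrakk> \<Longrightarrow> valid (f \<otimes> g)"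
  "A \<in> Obj \<Longrightarrow> valid (Id A)"
  "\<lbrakk>A \<in> Obj; B \<in> Obj; C \<in> Obj\<rbrakk> \<Longrightarrow> valid (As A B C)"
  "\<lbrakk>A \<in> Obj; B \<in> Obj; C \<in> Obj\<rbrakk> \<Longrightarrow> valid (As_inv A B C)"
  "A \<in> Obj \<Longrightarrow> valid (Ru A)"
  "A \<in> Obj \<Longrightarrow> valid (Ru_inv A)"
  "A \<in> Obj \<Longrightarrow> valid (Lu A)"
  "A \<in> Obj \<Longrightarrow> valid (Lu_inv A)"
  "\<lbrakk>A \<in> Obj; B \<in> Obj\<rbrakk> \<Longrightarrow> valid (Sy A B)"
  "\<lbrakk>A \<in> Obj; B \<in> Obj\<rbrakk> \<Longrightarrow> valid (ev A B)"
  "\<lbrakk>A \<in> Obj; C \<in> Obj; valid f; src f = A \<boxtimes> C\<rbrakk> \<Longrightarrow> valid (cur A C f)"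
  subgoal using comp_in_hom[of "src f" "tgt f" "tgt g" "raw f" "raw g"] by (simp add: valid_def arrow_defs del: valid_obj)
  subgoal by (simp add: valid_def arrow_defs tensor_in_hom del: valid_obj)
  subgoal by (simp add: valid_def arrow_defs ident_in_hom del: valid_obj)
  subgoal using inv_arrow_props(1)[of A B C] by (simp add: valid_def arrow_defs inverse_arrows_def del: valid_obj)
  subgoal using inv_arrow_props(1)[of A B C] by (simp add: valid_def arrow_defs inverse_arrows_def del: valid_obj)
  subgoal using inv_arrow_props(2)[of A A A] by (simp add: valid_def arrow_defs inverse_arrows_def del: valid_obj)
  subgoal using inv_arrow_props(2)[of A A A] by (simp add: valid_def arrow_defs inverse_arrows_def del: valid_obj)
  subgoal using inv_arrow_props(3)[of A A A] by (simp add: valid_def arrow_defs inverse_arrows_def del: valid_obj)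
  subgoal using inv_arrow_props(3)[of A A A] by (simp add: valid_def arrow_defs inverse_arrows_def del: valid_obj)
  subgoal by (simp add: valid_def arrow_defs symm_in_hom del: valid_obj)
  subgoal by (simp add: valid_def arrow_defs ev_in_hom del: valid_obj)
  subgoal by (simp add: valid_def arrow_defs adj_transpose_props(1) del: valid_obj)
  done

section \<open>Category laws, interchange and inverses as rewrite rules\<close>

lemma comp_arr_assoc [simp]:
  "\<lbrakk>valid f; valid g; valid h; src g = tgt f; src h = tgt g\<rbrakk> \<Longrightarrow> (h \<odot> g) \<odot> f = h \<odot> g \<odot> f"
  by (rule arrow_eqI) (auto simp: valid_def comp_arr_def simp del: valid_obj
      intro!: comp_assoc[of "src f" "tgt f" "tgt g" "tgt h"])

lemma comp_Id [simp]:
  "\<lbrakk>valid f; src f = A\<rbrakk> \<Longrightarrow> f \<odot> Id A = f"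
  "\<lbrakk>valid f; tgt f = A\<rbrakk> \<Longrightarrow> Id A \<odot> f = f"
  by (auto intro!: arrow_eqI simp: arrow_defs valid_def comp_ident_right comp_ident_left simp del: valid_obj)

lemma tensor_Id [simp]: "\<lbrakk>A \<in> Obj; B \<in> Obj\<rbrakk> \<Longrightarrow> Id A \<otimes> Id B = Id (A \<boxtimes> B)"
  by (simp add: arrow_defs tensor_ident)

lemma interchange [simp]:
  "\<lbrakk>valid f; valid g; valid f'; valid g'; src g = tgt f; src g' = tgt f'\<rbrakk>
    \<Longrightarrow> (g \<otimes> g') \<odot> (f \<otimes> f') = (g \<odot> f) \<otimes> (g' \<odot> f')"
  using tensor_comp[of "src f" "tgt f" "tgt g" "src f'" "tgt f'" "tgt g'" "raw f" "raw g" "raw f'" "raw g'"]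
  by (simp add: arrow_defs valid_def del: valid_obj)

text \<open>In a right-nested composite the pattern of \<open>interchange\<close> is hidden as soon
  as a further arrow \<open>h\<close> is present. This variant finds it there, as
  \<open>iso_comp_simps\<close> does for the inverse laws.\<close>

lemma interchange_comp [simp]:
  "\<lbrakk>valid f; valid g; valid f'; valid g'; valid h; src g = tgt f; src g' = tgt f';
    tgt h = src f \<boxtimes> src f'\<rbrakk>
    \<Longrightarrow> (g \<otimes> g') \<odot> (f \<otimes> f') \<odot> h = ((g \<odot> f) \<otimes> (g' \<odot> f')) \<odot> h"
  by (simp flip: comp_arr_assoc)

lemma iso_simps [simp]:
  "\<lbrakk>A \<in> Obj; B \<in> Obj; C \<in> Obj\<rbrakk> \<Longrightarrow> As A B C \<odot> As_inv A B C = Id (A \<boxtimes> (B \<boxtimes> C))"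
  "\<lbrakk>A \<in> Obj; B \<in> Obj; C \<in> Obj\<rbrakk> \<Longrightarrow> As_inv A B C \<odot> As A B C = Id ((A \<boxtimes> B) \<boxtimes> C)"
  "A \<in> Obj \<Longrightarrow> Ru A \<odot> Ru_inv A = Id A"
  "A \<in> Obj \<Longrightarrow> Ru_inv A \<odot> Ru A = Id (A \<boxtimes> \<I>)"
  "A \<in> Obj \<Longrightarrow> Lu A \<odot> Lu_inv A = Id A"
  "\<lbrakk>A \<in> Obj; B \<in> Obj\<rbrakk> \<Longrightarrow> Sy B A \<odot> Sy A B = Id (A \<boxtimes> B)"
  using inv_arrow_props[of A B C] inv_arrow_props[of A A A] symm_involution[of A B]
  by (simp_all add: arrow_defs inverse_arrows_def)

lemma iso_comp_simps [simp]:
  "\<lbrakk>A \<in> Obj; B \<in> Obj; C \<in> Obj; valid f; tgt f = A \<boxtimes> (B \<boxtimes> C)\<rbrakk>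
    \<Longrightarrow> As A B C \<odot> As_inv A B C \<odot> f = f"
  "\<lbrakk>A \<in> Obj; B \<in> Obj; C \<in> Obj; valid f; tgt f = (A \<boxtimes> B) \<boxtimes> C\<rbrakk>
    \<Longrightarrow> As_inv A B C \<odot> As A B C \<odot> f = f"
  "\<lbrakk>A \<in> Obj; valid f; tgt f = A\<rbrakk> \<Longrightarrow> Ru A \<odot> Ru_inv A \<odot> f = f"
  "\<lbrakk>A \<in> Obj; valid f; tgt f = A \<boxtimes> \<I>\<rbrakk> \<Longrightarrow> Ru_inv A \<odot> Ru A \<odot> f = f"
  "\<lbrakk>A \<in> Obj; valid f; tgt f = A\<rbrakk> \<Longrightarrow> Lu A \<odot> Lu_inv A \<odot> f = f"
  "\<lbrakk>A \<in> Obj; B \<in> Obj; valid f; tgt f = A \<boxtimes> B\<rbrakk> \<Longrightarrow> Sy B A \<odot> Sy A B \<odot> f = f"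
  by (simp_all flip: comp_arr_assoc)

section \<open>Naturality and coherence of the structure maps\<close>

lemma As_natural:
  "\<lbrakk>valid f; valid g; valid h\<rbrakk>
    \<Longrightarrow> As (tgt f) (tgt g) (tgt h) \<odot> ((f \<otimes> g) \<otimes> h)
      = (f \<otimes> (g \<otimes> h)) \<odot> As (src f) (src g) (src h)"
  by (simp add: arrow_defs valid_def assoc_natural del: valid_obj)

lemma As_inv_natural:
  assumes "valid f" "valid g" "valid h"
  shows "As_inv (tgt f) (tgt g) (tgt h) \<odot> (f \<otimes> (g \<otimes> h))
      = ((f \<otimes> g) \<otimes> h) \<odot> As_inv (src f) (src g) (src h)"
proof -
  have "As_inv (tgt f) (tgt g) (tgt h) \<odot> (f \<otimes> (g \<otimes> h))
      = As_inv (tgt f) (tgt g) (tgt h) \<odot> ((f \<otimes> (g \<otimes> h)) \<odot> As (src f) (src g) (src h))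
        \<odot> As_inv (src f) (src g) (src h)"
    using assms by simp
  also have "\<dots> = ((f \<otimes> g) \<otimes> h) \<odot> As_inv (src f) (src g) (src h)"
    using assms by (simp flip: As_natural)
  finally show ?thesis .
qed

lemma Ru_natural: "valid f \<Longrightarrow> Ru (tgt f) \<odot> (f \<otimes> Id \<I>) = f \<odot> Ru (src f)"
  by (simp add: arrow_defs valid_def runit_natural del: valid_obj)

lemma Sy_natural:
  "\<lbrakk>valid f; valid g\<rbrakk> \<Longrightarrow> Sy (tgt f) (tgt g) \<odot> (f \<otimes> g) = (g \<otimes> f) \<odot> Sy (src f) (src g)"
  by (simp add: arrow_defs valid_def symm_natural del: valid_obj)

lemma Ru_triangle:
  "\<lbrakk>A \<in> Obj; B \<in> Obj\<rbrakk> \<Longrightarrow> (Id A \<otimes> Lu B) \<odot> As A \<I> B = Ru A \<otimes> Id B"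
  by (simp add: arrow_defs triangle)

lemma As_pentagon:
  "\<lbrakk>A \<in> Obj; B \<in> Obj; C \<in> Obj; D \<in> Obj\<rbrakk>
    \<Longrightarrow> As A B (C \<boxtimes> D) \<odot> As (A \<boxtimes> B) C D
      = (Id A \<otimes> As B C D) \<odot> As A (B \<boxtimes> C) D \<odot> (As A B C \<otimes> Id D)"
proof -
  assume [simp]: "A \<in> Obj" "B \<in> Obj" "C \<in> Obj" "D \<in> Obj"
  have "As A B (C \<boxtimes> D) \<odot> As (A \<boxtimes> B) C D
      = ((Id A \<otimes> As B C D) \<odot> As A (B \<boxtimes> C) D) \<odot> (As A B C \<otimes> Id D)"
    using pentagon[of A B C D] by (simp add: arrow_defs)
  then show ?thesis by simp
qed

text \<open>Naturality of \<open>Ru\<close> recovers \<open>f\<close> from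
  \<open>f \<otimes> Id \<I>\<close> by conjugation with the invertible right unitors, so tensoring
  with the unit is faithful.\<close>

lemma tensor_unit_cancel:
  assumes "valid f" "valid g" "src f = src g" "tgt f = tgt g" "f \<otimes> Id \<I> = g \<otimes> Id \<I>"
  shows "f = g"
proof -
  have "f = (f \<odot> Ru (src f)) \<odot> Ru_inv (src f)" using assms(1) by simp
  also have "\<dots> = (g \<odot> Ru (src g)) \<odot> Ru_inv (src g)"
    using assms by (metis Ru_natural)
  also have "\<dots> = g" using assms(2) by simp
  finally show ?thesis .
qed

text \<open>Kelly's coherence lemma: compare both sides after tensoring with the unit, where the
  pentagon and the triangle apply.\<close>

lemma Ru_tensor:
  assumes [simp]: "A \<in> Obj" "B \<in> Obj"
  shows "(Id A \<otimes> Ru B) \<odot> As A B \<I> = Ru (A \<boxtimes> B)"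
proof (rule tensor_unit_cancel)
  have "As A B \<I> \<odot> (Ru (A \<boxtimes> B) \<otimes> Id \<I>)
      = As A B \<I> \<odot> ((Id A \<otimes> Id B) \<otimes> Lu \<I>) \<odot> As (A \<boxtimes> B) \<I> \<I>"
    by (simp flip: Ru_triangle)
  also have "\<dots> = (As A B \<I> \<odot> ((Id A \<otimes> Id B) \<otimes> Lu \<I>)) \<odot> As (A \<boxtimes> B) \<I> \<I>"
    by simp
  also have "\<dots> = (Id A \<otimes> (Id B \<otimes> Lu \<I>)) \<odot> As A B (\<I> \<boxtimes> \<I>) \<odot> As (A \<boxtimes> B) \<I> \<I>"
    using As_natural[of "Id A" "Id B" "Lu \<I>"] by simp
  also have "\<dots> = (Id A \<otimes> ((Id B \<otimes> Lu \<I>) \<odot> As B \<I> \<I>)) \<odot> As A (B \<boxtimes> \<I>) \<I> \<odot> (As A B \<I> \<otimes> Id \<I>)"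
    by (simp add: As_pentagon)
  also have "\<dots> = ((Id A \<otimes> (Ru B \<otimes> Id \<I>)) \<odot> As A (B \<boxtimes> \<I>) \<I>) \<odot> (As A B \<I> \<otimes> Id \<I>)"
    by (simp add: Ru_triangle)
  also have "\<dots> = (As A B \<I> \<odot> ((Id A \<otimes> Ru B) \<otimes> Id \<I>)) \<odot> (As A B \<I> \<otimes> Id \<I>)"
    using As_natural[of "Id A" "Ru B" "Id \<I>"] by simp
  also have "\<dots> = As A B \<I> \<odot> (((Id A \<otimes> Ru B) \<odot> As A B \<I>) \<otimes> Id \<I>)"
    by simp
  finally have "As_inv A B \<I> \<odot> As A B \<I> \<odot> (Ru (A \<boxtimes> B) \<otimes> Id \<I>)
      = As_inv A B \<I> \<odot> As A B \<I> \<odot> (((Id A \<otimes> Ru B) \<odot> As A B \<I>) \<otimes> Id \<I>)"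
    by simp
  then show "((Id A \<otimes> Ru B) \<odot> As A B \<I>) \<otimes> Id \<I> = Ru (A \<boxtimes> B) \<otimes> Id \<I>"
    by simp
qed simp_all

section \<open>Transposition along the tensor-hom adjunction\<close>

lemma ev_cur [simp]:
  "\<lbrakk>A \<in> Obj; C \<in> Obj; valid f; src f = A \<boxtimes> C; tgt f = B\<rbrakk> \<Longrightarrow> ev A B \<odot> (Id A \<otimes> cur A C f) = f"
  by (rule arrow_eqI) (auto simp: arrow_defs valid_def adj_transpose_props(2) simp del: valid_obj)

text \<open>The uniqueness half of \<open>ev_universal\<close>. Equations between arrows into an
  internal hom are proved below by comparing their evaluations.\<close>

lemma ev_cancel:
  assumes "A \<in> Obj" "B \<in> Obj" "valid u" "valid v" "src u = src v"
    and "tgt u = A \<multimap> B" "tgt v = A \<multimap> B"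
    and "ev A B \<odot> (Id A \<otimes> u) = ev A B \<odot> (Id A \<otimes> v)"
  shows "u = v"
proof -
  have raw_ev: "raw (ev A B \<odot> (Id A \<otimes> w)) = Ev A B \<cdot> (\<one> A \<boxtimes>\<^sub>1 raw w)" for w
    by (simp add: arrow_defs)
  have "valid (ev A B \<odot> (Id A \<otimes> u))"
    using assms(1-4,6) by simp
  then have "Ev A B \<cdot> (\<one> A \<boxtimes>\<^sub>1 raw u) \<in> Hom (A \<boxtimes> src u) B"
    by (simp add: valid_def raw_ev del: valid_obj)
  then have "\<exists>!g. g \<in> Hom (src u) (A \<multimap> B) \<and> Ev A B \<cdot> (\<one> A \<boxtimes>\<^sub>1 g) = Ev A B \<cdot> (\<one> A \<boxtimes>\<^sub>1 raw u)"
    using assms(1-3) by (intro ev_universal) simp_all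
  moreover have "raw u \<in> Hom (src u) (A \<multimap> B)" "raw v \<in> Hom (src u) (A \<multimap> B)"
    using assms(3-7) by (simp_all add: valid_def del: valid_obj)
  moreover have "Ev A B \<cdot> (\<one> A \<boxtimes>\<^sub>1 raw v) = Ev A B \<cdot> (\<one> A \<boxtimes>\<^sub>1 raw u)"
    using arg_cong[OF assms(8), of raw] by (simp add: raw_ev)
  ultimately have "raw u = raw v" by blast
  with assms(5-7) show ?thesis by (simp add: arrow_eqI)
qed

lemma cur_ev:
  assumes "A \<in> Obj" "B \<in> Obj" "valid u" "tgt u = A \<multimap> B"
  shows "cur A (src u) (ev A B \<odot> (Id A \<otimes> u)) = u"
  by (rule ev_cancel[of A B]) (use assms in simp_all)

lemma cur_comp:
  assumes "A \<in> Obj" "C \<in> Obj" "valid f" "src f = A \<boxtimes> C" "valid h" "tgt h = C"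
  shows "cur A (src h) (f \<odot> (Id A \<otimes> h)) = cur A C f \<odot> h"
proof (rule ev_cancel[of A "tgt f"])
  \<comment> \<open>With \<open>ev_cur\<close> active the right-hand side would collapse before the
    interchange law could make it agree with the left-hand side.\<close>
  have "ev A (tgt f) \<odot> (Id A \<otimes> (cur A C f \<odot> h)) = (ev A (tgt f) \<odot> (Id A \<otimes> cur A C f)) \<odot> (Id A \<otimes> h)"
    using assms by (simp del: ev_cur)
  also have "\<dots> = f \<odot> (Id A \<otimes> h)" using assms by simp
  finally show "ev A (tgt f) \<odot> (Id A \<otimes> cur A (src h) (f \<odot> (Id A \<otimes> h)))
      = ev A (tgt f) \<odot> (Id A \<otimes> (cur A C f \<odot> h))"
    using assms by simp
qed (use assms in simp_all)


section \<open>Enriched functors\<close>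

text \<open>The typing part of \<open>is_enriched_functor\<close>. Splitting it off lets composites
  of functors be used in naturality statements after a mere typing check.\<close>

definition typed_functor :: "('o, 'a, 'n) enriched_functor_scheme \<Rightarrow> bool" where
  "typed_functor T \<longleftrightarrow> (\<forall>A\<in>Obj. on_obj T A \<in> Obj) \<and>
     (\<forall>A\<in>Obj. \<forall>B\<in>Obj. on_hom T A B \<in> Hom (A \<multimap> B) (on_obj T A \<multimap> on_obj T B))"

definition hom_map :: "('o, 'a, 'n) enriched_functor_scheme \<Rightarrow> 'o \<Rightarrow> 'o \<Rightarrow> ('o, 'a) typed_arrow" where
  "hom_map T A B = Arrow (A \<multimap> B) (on_obj T A \<multimap> on_obj T B) (on_hom T A B)"

text \<open>The action \<open>T A \<boxtimes> C \<rightarrow> T B\<close> of \<open>T\<close> on a family \<open>g : A \<boxtimes> C \<rightarrow> B\<close> of arrows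
  parametrised by \<open>C\<close>.\<close>

definition act ::
    "('o, 'a, 'n) enriched_functor_scheme \<Rightarrow> 'o \<Rightarrow> 'o \<Rightarrow> ('o, 'a) typed_arrow \<Rightarrow> ('o, 'a) typed_arrow" where
  "act T A C g = ev (on_obj T A) (on_obj T (tgt g))
     \<odot> (Id (on_obj T A) \<otimes> (hom_map T A (tgt g) \<odot> cur A C g))"

text \<open>A single arrow is a family parametrised by \<open>\<I>\<close>; the right unitors pass
  between the two views, exactly as in \<open>on_arr\<close>.\<close>

definition fmap :: "('o, 'a, 'n) enriched_functor_scheme \<Rightarrow> ('o, 'a) typed_arrow \<Rightarrow> ('o, 'a) typed_arrow" where
  "fmap T f = act T (src f) \<I> (f \<odot> Ru (src f)) \<odot> Ru_inv (on_obj T (src f))"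

text \<open>\<open>tl\<close> and \<open>tr\<close> are the strengths \<open>t'\<close> and \<open>t''\<close>.\<close>

definition tl :: "('o, 'a, 'n) enriched_functor_scheme \<Rightarrow> 'o \<Rightarrow> 'o \<Rightarrow> ('o, 'a) typed_arrow" where
  "tl T A B = act T A B (Id (A \<boxtimes> B))"

definition tr :: "('o, 'a, 'n) enriched_functor_scheme \<Rightarrow> 'o \<Rightarrow> 'o \<Rightarrow> ('o, 'a) typed_arrow" where
  "tr T A B = act T B A (Sy B A) \<odot> Sy A (on_obj T B)"

lemma raw_simps:
  "raw (g \<odot> f) = raw g \<cdot> raw f"
  "raw (f \<otimes> g) = raw f \<boxtimes>\<^sub>1 raw g"
  "raw (hom_map T A B) = on_hom T A B"
  by (simp_all add: arrow_defs hom_map_def)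

text \<open>This lemma and the next two hold by unfolding; they carry typed equations over to the
  given definitions of the functor action and the strengths.\<close>

lemma raw_fmap: "raw (fmap T f) = on_arr X T (src f) (tgt f) (raw f)"
  by (simp add: fmap_def act_def hom_map_def arrow_defs on_arr_def arrow_of_def name_of_def
      adj_untranspose_def)

lemma raw_tl: "raw (tl T A B) = strength_left X T A B"
  by (simp add: tl_def act_def hom_map_def arrow_defs strength_left_def adj_untranspose_def)

lemma raw_tr: "raw (tr T A B) = strength_right X T A B"
  by (simp add: tr_def act_def hom_map_def arrow_defs strength_right_def adj_untranspose_def)

lemma functor_src_tgt [simp]:
  "src (hom_map T A B) = A \<multimap> B" "tgt (hom_map T A B) = on_obj T A \<multimap> on_obj T B"
  "src (act T A C g) = on_obj T A \<boxtimes> C" "tgt (act T A C g) = on_obj T (tgt g)"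
  "src (fmap T f) = on_obj T (src f)" "tgt (fmap T f) = on_obj T (tgt f)"
  "src (tl T A B) = on_obj T A \<boxtimes> B" "tgt (tl T A B) = on_obj T (A \<boxtimes> B)"
  "src (tr T A B) = A \<boxtimes> on_obj T B" "tgt (tr T A B) = on_obj T (A \<boxtimes> B)"
  by (simp_all add: hom_map_def act_def fmap_def tl_def tr_def)

lemma functor_valid [simp]:
  assumes "typed_functor T"
  shows "A \<in> Obj \<Longrightarrow> on_obj T A \<in> Obj"
    and "\<lbrakk>A \<in> Obj; B \<in> Obj\<rbrakk> \<Longrightarrow> valid (hom_map T A B)"
    and "\<lbrakk>A \<in> Obj; C \<in> Obj; valid g; src g = A \<boxtimes> C\<rbrakk> \<Longrightarrow> valid (act T A C g)"
    and "valid f \<Longrightarrow> valid (fmap T f)"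
    and "\<lbrakk>A \<in> Obj; B \<in> Obj\<rbrakk> \<Longrightarrow> valid (tl T A B)"
    and "\<lbrakk>A \<in> Obj; B \<in> Obj\<rbrakk> \<Longrightarrow> valid (tr T A B)"
proof -
  show *: "on_obj T A \<in> Obj" if "A \<in> Obj" for A
    using assms that by (simp add: typed_functor_def)
  show **: "valid (hom_map T A B)" if "A \<in> Obj" "B \<in> Obj" for A B
    using assms that by (simp add: typed_functor_def hom_map_def valid_def del: valid_obj)
  show ***: "valid (act T A C g)"
    if "A \<in> Obj" "C \<in> Obj" "valid g" "src g = A \<boxtimes> C" for A C g
    using that by (simp add: act_def * **)
  show "valid (fmap T f)" if "valid f" using that by (simp add: fmap_def * ***)
  show "valid (tl T A B)" if "A \<in> Obj" "B \<in> Obj" using that by (simp add: tl_def ***)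
  show "valid (tr T A B)" if "A \<in> Obj" "B \<in> Obj" using that by (simp add: tr_def * ***)
qed

section \<open>The action on families: change of parameter and composition\<close>

lemma cur_act:
  assumes "typed_functor T" "A \<in> Obj" "C \<in> Obj" "valid g" "src g = A \<boxtimes> C"
  shows "cur (on_obj T A) C (act T A C g) = hom_map T A (tgt g) \<odot> cur A C g"
  using cur_ev[of "on_obj T A" "on_obj T (tgt g)" "hom_map T A (tgt g) \<odot> cur A C g"] assms
  by (simp add: act_def)

lemma act_param:
  assumes "typed_functor T" "A \<in> Obj" "C \<in> Obj" "valid g" "src g = A \<boxtimes> C" "valid h" "tgt h = C"
  shows "act T A (src h) (g \<odot> (Id A \<otimes> h)) = act T A C g \<odot> (Id (on_obj T A) \<otimes> h)"
  using assms by (simp add: act_def cur_comp)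

text \<open>The bracketing copies the left-associated composite in \<open>self_comp\<close>, so that
  the raw arrows agree by unfolding.\<close>

definition self_comp_arr :: "'o \<Rightarrow> 'o \<Rightarrow> 'o \<Rightarrow> ('o, 'a) typed_arrow" where
  "self_comp_arr A B C = cur A ((B \<multimap> C) \<boxtimes> (A \<multimap> B))
     (((ev B C \<odot> (ev A B \<otimes> Id (B \<multimap> C))) \<odot> As_inv A (A \<multimap> B) (B \<multimap> C))
      \<odot> (Id A \<otimes> Sy (B \<multimap> C) (A \<multimap> B)))"

lemma self_comp_arr_simps [simp]:
  "src (self_comp_arr A B C) = (B \<multimap> C) \<boxtimes> (A \<multimap> B)"
  "tgt (self_comp_arr A B C) = A \<multimap> C"
  "\<lbrakk>A \<in> Obj; B \<in> Obj; C \<in> Obj\<rbrakk> \<Longrightarrow> valid (self_comp_arr A B C)"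
  by (simp_all add: self_comp_arr_def)

text \<open>If \<open>u\<close> and \<open>v\<close> are transposes of two families, their composite
  in the self-enrichment is the transpose of the family that runs the first and then the second,
  parametrised by the tensor of both parameters.\<close>

lemma self_comp_arr_tensor:
  assumes [simp]: "A \<in> Obj" "B \<in> Obj" "E \<in> Obj" "valid u" "tgt u = A \<multimap> B" "valid v" "tgt v = B \<multimap> E"
  shows "self_comp_arr A B E \<odot> (v \<otimes> u) \<odot> Sy (src u) (src v)
    = cur A (src u \<boxtimes> src v) ((ev B E \<odot> (Id B \<otimes> v)) \<odot> ((ev A B \<odot> (Id A \<otimes> u)) \<otimes> Id (src v))
        \<odot> As_inv A (src u) (src v))"
proof (rule ev_cancel[of A E])
  \<comment> \<open>Composition takes the later map \<open>v\<close> first and swaps the factors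
    internally; the outer \<open>Sy\<close> undoes this, so that evaluation meets \<open>u\<close>
    before \<open>v\<close>.\<close>
  have swap: "Sy (B \<multimap> E) (A \<multimap> B) \<odot> (v \<otimes> u) \<odot> Sy (src u) (src v) = u \<otimes> v"
  proof -
    have "Sy (B \<multimap> E) (A \<multimap> B) \<odot> (v \<otimes> u) \<odot> Sy (src u) (src v)
        = (Sy (B \<multimap> E) (A \<multimap> B) \<odot> (v \<otimes> u)) \<odot> Sy (src u) (src v)"
      by simp
    also have "\<dots> = u \<otimes> v"
      using Sy_natural[of v u] by simp
    finally show ?thesis .
  qed
  have "ev A E \<odot> (Id A \<otimes> (self_comp_arr A B E \<odot> (v \<otimes> u) \<odot> Sy (src u) (src v)))
      = (ev A E \<odot> (Id A \<otimes> self_comp_arr A B E)) \<odot> (Id A \<otimes> ((v \<otimes> u) \<odot> Sy (src u) (src v)))"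
    by simp
  also have "\<dots> = ev B E \<odot> (ev A B \<otimes> Id (B \<multimap> E)) \<odot> As_inv A (A \<multimap> B) (B \<multimap> E)
      \<odot> (Id A \<otimes> (Sy (B \<multimap> E) (A \<multimap> B) \<odot> (v \<otimes> u) \<odot> Sy (src u) (src v)))"
    by (simp add: self_comp_arr_def)
  also have "\<dots> = ev B E \<odot> (ev A B \<otimes> Id (B \<multimap> E)) \<odot> ((Id A \<otimes> u) \<otimes> v) \<odot> As_inv A (src u) (src v)"
    unfolding swap using As_inv_natural[of "Id A" u v] by simp
  also have "\<dots> = (ev B E \<odot> (Id B \<otimes> v)) \<odot> ((ev A B \<odot> (Id A \<otimes> u)) \<otimes> Id (src v))
        \<odot> As_inv A (src u) (src v)"
    by simp
  finally show "ev A E \<odot> (Id A \<otimes> (self_comp_arr A B E \<odot> (v \<otimes> u) \<odot> Sy (src u) (src v)))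
      = ev A E \<odot> (Id A \<otimes> cur A (src u \<boxtimes> src v) ((ev B E \<odot> (Id B \<otimes> v))
          \<odot> ((ev A B \<odot> (Id A \<otimes> u)) \<otimes> Id (src v)) \<odot> As_inv A (src u) (src v)))"
    by simp
qed simp_all

lemma typed_functor_if_enriched: "is_enriched_functor X T \<Longrightarrow> typed_functor T"
  by (simp add: is_enriched_functor_def typed_functor_def)

lemma hom_map_comp:
  assumes "is_enriched_functor X T" "A \<in> Obj" "B \<in> Obj" "C \<in> Obj"
  shows "hom_map T A C \<odot> self_comp_arr A B C
    = self_comp_arr (on_obj T A) (on_obj T B) (on_obj T C) \<odot> (hom_map T B C \<otimes> hom_map T A B)"
proof -
  have "raw (self_comp_arr A B C) = self_comp X A B C" for A B C
    by (simp add: self_comp_arr_def self_comp_def arrow_defs)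
  with assms show ?thesis
    by (intro arrow_eqI) (simp_all add: raw_simps is_enriched_functor_def)
qed

text \<open>The composition law of the enriched functor, with \<open>self_comp_arr_tensor\<close>
  translating both sides into composites of families. Compatibility with single arrows follows by
  setting one parameter to \<open>\<I>\<close>.\<close>

lemma act_comp:
  assumes T: "is_enriched_functor X T"
    and [simp]: "A \<in> Obj" "B \<in> Obj" "C \<in> Obj" "D \<in> Obj" "valid g" "src g = A \<boxtimes> C" "tgt g = B"
      "valid h" "src h = B \<boxtimes> D"
  shows "act T A (C \<boxtimes> D) (h \<odot> (g \<otimes> Id D) \<odot> As_inv A C D)
    = act T B D h \<odot> (act T A C g \<otimes> Id D) \<odot> As_inv (on_obj T A) C D"
proof -
  have [simp]: "typed_functor T" using T by (rule typed_functor_if_enriched)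
  let ?u = "cur A C g" and ?v = "cur B D h" and ?E = "tgt h"
  have "hom_map T A ?E \<odot> cur A (C \<boxtimes> D) (h \<odot> (g \<otimes> Id D) \<odot> As_inv A C D)
      = (hom_map T A ?E \<odot> self_comp_arr A B ?E) \<odot> (?v \<otimes> ?u) \<odot> Sy C D"
    using self_comp_arr_tensor[of A B ?E ?u ?v] by simp
  also have "\<dots> = self_comp_arr (on_obj T A) (on_obj T B) (on_obj T ?E)
      \<odot> ((hom_map T B ?E \<odot> ?v) \<otimes> (hom_map T A B \<odot> ?u)) \<odot> Sy C D"
    using T by (simp add: hom_map_comp)
  also have "\<dots> = cur (on_obj T A) (C \<boxtimes> D)
      (act T B D h \<odot> (act T A C g \<otimes> Id D) \<odot> As_inv (on_obj T A) C D)"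
    using self_comp_arr_tensor[of "on_obj T A" "on_obj T B" "on_obj T ?E"
        "hom_map T A B \<odot> ?u" "hom_map T B ?E \<odot> ?v"]
    by (simp add: act_def)
  \<comment> \<open>The equation between transposes is evaluated: unfolding only the
    \<open>act\<close> on the left exposes its transpose, and \<open>ev_cur\<close> removes the
    \<open>cur\<close> on the right.\<close>
  finally show ?thesis
    by (simp add: act_def[of T A "C \<boxtimes> D"])
qed

section \<open>Composition of families with single arrows, and naturality of the strengths\<close>

lemma fmap_Ru:
  "\<lbrakk>typed_functor T; valid f\<rbrakk>
    \<Longrightarrow> act T (src f) \<I> (f \<odot> Ru (src f)) = fmap T f \<odot> Ru (on_obj T (src f))"
  by (simp add: fmap_def)

text \<open>This is \<open>act_comp\<close> with \<open>f\<close> as a second family over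
  \<open>\<I>\<close>. \<open>Ru_tensor\<close> identifies the parameter
  \<open>C \<boxtimes> \<I>\<close> with \<open>C\<close>, and the invertible arrow
  \<open>Id (on_obj T A) \<otimes> Ru C\<close> is cancelled at the end.\<close>

lemma act_post:
  assumes T: "is_enriched_functor X T"
    and [simp]: "A \<in> Obj" "C \<in> Obj" "valid g" "src g = A \<boxtimes> C" "valid f" "src f = tgt g"
  shows "act T A C (f \<odot> g) = fmap T f \<odot> act T A C g"
proof -
  have [simp]: "typed_functor T" using T by (rule typed_functor_if_enriched)
  have Ru_As: "Ru (B \<boxtimes> C) \<odot> As_inv B C \<I> = Id B \<otimes> Ru C" if "B \<in> Obj" for B
    using that by (simp flip: Ru_tensor)
  have "act T A C (f \<odot> g) \<odot> (Id (on_obj T A) \<otimes> Ru C) = act T A (C \<boxtimes> \<I>) ((f \<odot> g) \<odot> (Id A \<otimes> Ru C))"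
    using act_param[of T A C "f \<odot> g" "Ru C"] by simp
  also have "(f \<odot> g) \<odot> (Id A \<otimes> Ru C) = f \<odot> (g \<odot> Ru (A \<boxtimes> C)) \<odot> As_inv A C \<I>"
    by (simp add: Ru_As)
  also have "\<dots> = (f \<odot> Ru (tgt g)) \<odot> (g \<otimes> Id \<I>) \<odot> As_inv A C \<I>"
  proof -
    have "f \<odot> (g \<odot> Ru (A \<boxtimes> C)) \<odot> As_inv A C \<I>
        = f \<odot> (Ru (tgt g) \<odot> (g \<otimes> Id \<I>)) \<odot> As_inv A C \<I>"
      using Ru_natural[of g] by simp
    then show ?thesis by simp
  qed
  also have "act T A (C \<boxtimes> \<I>) \<dots>
      = act T (tgt g) \<I> (f \<odot> Ru (tgt g)) \<odot> (act T A C g \<otimes> Id \<I>) \<odot> As_inv (on_obj T A) C \<I>"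
    by (rule act_comp[OF T]) simp_all
  also have "\<dots> = fmap T f \<odot> (Ru (on_obj T (tgt g)) \<odot> (act T A C g \<otimes> Id \<I>)) \<odot> As_inv (on_obj T A) C \<I>"
    using fmap_Ru[of T f] by simp
  also have "\<dots> = (fmap T f \<odot> act T A C g) \<odot> (Id (on_obj T A) \<otimes> Ru C)"
    using Ru_natural[of "act T A C g"] by (simp add: Ru_As)
  finally have "(act T A C (f \<odot> g) \<odot> (Id (on_obj T A) \<otimes> Ru C)) \<odot> (Id (on_obj T A) \<otimes> Ru_inv C)
      = ((fmap T f \<odot> act T A C g) \<odot> (Id (on_obj T A) \<otimes> Ru C)) \<odot> (Id (on_obj T A) \<otimes> Ru_inv C)"
    by simp
  then show ?thesis by simp
qed

text \<open>Dual use of \<open>act_comp\<close>: now the first family is the one over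
  \<open>\<I>\<close>, so the triangle identity and the left unitor do the work of
  \<open>Ru_tensor\<close> and the right unitor.\<close>

lemma act_pre:
  assumes T: "is_enriched_functor X T"
    and [simp]: "A \<in> Obj" "C \<in> Obj" "valid g" "src g = A \<boxtimes> C" "valid f" "tgt f = A"
  shows "act T (src f) C (g \<odot> (f \<otimes> Id C)) = act T A C g \<odot> (fmap T f \<otimes> Id C)"
proof -
  have [simp]: "typed_functor T" using T by (rule typed_functor_if_enriched)
  have Ru_As: "(Ru B \<otimes> Id C) \<odot> As_inv B \<I> C = Id B \<otimes> Lu C" if "B \<in> Obj" for B
    using that by (simp flip: Ru_triangle)
  \<comment> \<open>Stated for a general \<open>h\<close> because it is applied to \<open>f\<close>
    inside the action and to \<open>fmap T f\<close> outside it.\<close>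
  have tensor_split: "((h \<odot> Ru (src h)) \<otimes> Id C) \<odot> As_inv (src h) \<I> C = (h \<otimes> Id C) \<odot> (Id (src h) \<otimes> Lu C)"
    if "valid h" for h
  proof -
    have "((h \<odot> Ru (src h)) \<otimes> Id C) \<odot> As_inv (src h) \<I> C
        = (h \<otimes> Id C) \<odot> ((Ru (src h) \<otimes> Id C) \<odot> As_inv (src h) \<I> C)"
      using that by simp
    then show ?thesis using that by (simp only: Ru_As valid_obj)
  qed
  have "act T (src f) C (g \<odot> (f \<otimes> Id C)) \<odot> (Id (on_obj T (src f)) \<otimes> Lu C)
      = act T (src f) (\<I> \<boxtimes> C) ((g \<odot> (f \<otimes> Id C)) \<odot> (Id (src f) \<otimes> Lu C))"
    using act_param[of T "src f" C "g \<odot> (f \<otimes> Id C)" "Lu C"] by simp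
  also have "(g \<odot> (f \<otimes> Id C)) \<odot> (Id (src f) \<otimes> Lu C)
      = g \<odot> ((f \<odot> Ru (src f)) \<otimes> Id C) \<odot> As_inv (src f) \<I> C"
    by (simp add: tensor_split)
  also have "act T (src f) (\<I> \<boxtimes> C) \<dots>
      = act T A C g \<odot> (act T (src f) \<I> (f \<odot> Ru (src f)) \<otimes> Id C) \<odot> As_inv (on_obj T (src f)) \<I> C"
    by (rule act_comp[OF T]) simp_all
  also have "\<dots> = (act T A C g \<odot> (fmap T f \<otimes> Id C)) \<odot> (Id (on_obj T (src f)) \<otimes> Lu C)"
    using tensor_split[of "fmap T f"] by (simp add: fmap_Ru)
  finally have "(act T (src f) C (g \<odot> (f \<otimes> Id C)) \<odot> (Id (on_obj T (src f)) \<otimes> Lu C))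
        \<odot> (Id (on_obj T (src f)) \<otimes> Lu_inv C)
      = ((act T A C g \<odot> (fmap T f \<otimes> Id C)) \<odot> (Id (on_obj T (src f)) \<otimes> Lu C))
        \<odot> (Id (on_obj T (src f)) \<otimes> Lu_inv C)"
    by simp
  then show ?thesis by simp
qed

lemma fmap_comp:
  assumes T: "is_enriched_functor X T" and "valid f" "valid g" "src g = tgt f"
  shows "fmap T (g \<odot> f) = fmap T g \<odot> fmap T f"
proof -
  have "typed_functor T" using T by (rule typed_functor_if_enriched)
  with assms show ?thesis
    using act_post[OF T, of "src f" \<I> "f \<odot> Ru (src f)" g] by (simp add: fmap_def[of T "g \<odot> f"] fmap_def[of T f])
qed

text \<open>Every family arises from the identity family on \<open>A \<boxtimes> C\<close> by
  postcomposition, and \<open>tl\<close> is the action on that family.\<close>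

lemma act_eq_fmap_tl:
  assumes T: "is_enriched_functor X T" and "A \<in> Obj" "C \<in> Obj" "valid g" "src g = A \<boxtimes> C"
  shows "act T A C g = fmap T g \<odot> tl T A C"
  using act_post[OF T, of A C "Id (A \<boxtimes> C)" g] assms by (simp add: tl_def)

text \<open>Both sides are the action on the family \<open>Id A \<otimes> h\<close>, by
  \<open>act_param\<close> and by \<open>act_eq_fmap_tl\<close>.\<close>

lemma tl_natural:
  assumes T: "is_enriched_functor X T" and "A \<in> Obj" "valid h"
  shows "tl T A (tgt h) \<odot> (Id (on_obj T A) \<otimes> h) = fmap T (Id A \<otimes> h) \<odot> tl T A (src h)"
  using act_param[of T A "tgt h" "Id (A \<boxtimes> tgt h)" h] assms act_eq_fmap_tl[OF T, of A "src h" "Id A \<otimes> h"]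
  by (simp add: tl_def typed_functor_if_enriched)

text \<open>After the symmetry, \<open>fmap T f\<close> acts on the argument of the family, where
  \<open>act_pre\<close> absorbs it. Naturality of the symmetry moves \<open>f\<close> to the
  output, and \<open>act_post\<close> extracts it again.\<close>

lemma tr_natural:
  assumes T: "is_enriched_functor X T" and [simp]: "A \<in> Obj" "valid f"
  shows "tr T A (tgt f) \<odot> (Id A \<otimes> fmap T f) = fmap T (Id A \<otimes> f) \<odot> tr T A (src f)"
proof -
  have [simp]: "typed_functor T" using T by (rule typed_functor_if_enriched)
  have "tr T A (tgt f) \<odot> (Id A \<otimes> fmap T f)
      = act T (tgt f) A (Sy (tgt f) A) \<odot> (fmap T f \<otimes> Id A) \<odot> Sy A (on_obj T (src f))"
    using Sy_natural[of "Id A" "fmap T f"] by (simp add: tr_def)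
  also have "\<dots> = act T (src f) A (Sy (tgt f) A \<odot> (f \<otimes> Id A)) \<odot> Sy A (on_obj T (src f))"
    using act_pre[OF T, of "tgt f" A "Sy (tgt f) A" f] by simp
  also have "Sy (tgt f) A \<odot> (f \<otimes> Id A) = (Id A \<otimes> f) \<odot> Sy (src f) A"
    using Sy_natural[of f "Id A"] by simp
  also have "act T (src f) A \<dots> \<odot> Sy A (on_obj T (src f)) = fmap T (Id A \<otimes> f) \<odot> tr T A (src f)"
    using act_post[OF T, of "src f" A "Sy (src f) A" "Id A \<otimes> f"] by (simp add: tr_def)
  finally show ?thesis .
qed

section \<open>Enriched natural transformations\<close>

definition post :: "'o \<Rightarrow> ('o, 'a) typed_arrow \<Rightarrow> ('o, 'a) typed_arrow" where
  "post A f = cur A (A \<multimap> src f) (f \<odot> ev A (src f))"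

definition pre :: "('o, 'a) typed_arrow \<Rightarrow> 'o \<Rightarrow> ('o, 'a) typed_arrow" where
  "pre f C = cur (src f) (tgt f \<multimap> C) (ev (tgt f) C \<odot> (f \<otimes> Id (tgt f \<multimap> C)))"

definition component ::
    "('o, 'a, 'n) enriched_functor_scheme \<Rightarrow> ('o, 'a, 'k) enriched_functor_scheme
      \<Rightarrow> ('o \<Rightarrow> 'a) \<Rightarrow> 'o \<Rightarrow> ('o, 'a) typed_arrow" where
  "component S T \<theta> A = Arrow (on_obj S A) (on_obj T A) (\<theta> A)"

lemma post_pre_simps [simp]:
  "src (post A f) = A \<multimap> src f" "tgt (post A f) = A \<multimap> tgt f"
  "src (pre f C) = tgt f \<multimap> C" "tgt (pre f C) = src f \<multimap> C"
  "\<lbrakk>A \<in> Obj; valid f\<rbrakk> \<Longrightarrow> valid (post A f)"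
  "\<lbrakk>C \<in> Obj; valid f\<rbrakk> \<Longrightarrow> valid (pre f C)"
  by (simp_all add: post_def pre_def)

lemma raw_post: "raw (post A f) = ihom_post X A (src f) (tgt f) (raw f)"
  by (simp add: post_def ihom_post_def arrow_defs)

lemma raw_pre: "raw (pre f C) = ihom_pre X (src f) (tgt f) C (raw f)"
  by (simp add: pre_def ihom_pre_def arrow_defs)

lemma component_simps [simp]:
  "src (component S T \<theta> A) = on_obj S A" "tgt (component S T \<theta> A) = on_obj T A"
  "raw (component S T \<theta> A) = \<theta> A"
  by (simp_all add: component_def)

lemma component_valid:
  "\<lbrakk>typed_functor S; typed_functor T; enriched_natural X S T \<theta>; A \<in> Obj\<rbrakk>
    \<Longrightarrow> valid (component S T \<theta> A)"
  by (simp add: typed_functor_def enriched_natural_def valid_def component_def del: valid_obj)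

lemma ev_post:
  assumes "A \<in> Obj" "valid f" "valid u" "tgt u = A \<multimap> src f" "tgt f = B"
  shows "ev A B \<odot> (Id A \<otimes> (post A f \<odot> u)) = f \<odot> ev A (src f) \<odot> (Id A \<otimes> u)"
proof -
  have [simp]: "B \<in> Obj" using assms by auto
  have "ev A B \<odot> (Id A \<otimes> (post A f \<odot> u)) = (ev A B \<odot> (Id A \<otimes> post A f)) \<odot> (Id A \<otimes> u)"
    using assms by simp
  then show ?thesis using assms by (simp add: post_def)
qed

lemma ev_pre:
  assumes "C \<in> Obj" "valid f" "valid u" "tgt u = tgt f \<multimap> C" "src f = A"
  shows "ev A C \<odot> (Id A \<otimes> (pre f C \<odot> u)) = ev (tgt f) C \<odot> (f \<otimes> u)"
proof -
  have [simp]: "A \<in> Obj" using assms by auto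
  have "ev A C \<odot> (Id A \<otimes> (pre f C \<odot> u)) = (ev A C \<odot> (Id A \<otimes> pre f C)) \<odot> (Id A \<otimes> u)"
    using assms by (auto simp del: ev_cur)
  also have "ev A C \<odot> (Id A \<otimes> pre f C) = ev (tgt f) C \<odot> (f \<otimes> Id (tgt f \<multimap> C))"
    using assms unfolding pre_def by auto
  finally show ?thesis using assms by simp
qed

text \<open>Enriched naturality is a square of arrows between hom-objects. Composing it with the
  transpose of \<open>g\<close> and evaluating, by \<open>ev_post\<close> on one side and
  \<open>ev_pre\<close> on the other, gives naturality for parametrised families.\<close>

lemma act_enriched_natural:
  assumes [simp]: "typed_functor S" "typed_functor T" and nat: "enriched_natural X S T \<theta>"
    and [simp]: "A \<in> Obj" "C \<in> Obj" "valid g" "src g = A \<boxtimes> C"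
  shows "component S T \<theta> (tgt g) \<odot> act S A C g = act T A C g \<odot> (component S T \<theta> A \<otimes> Id C)"
proof -
  let ?B = "tgt g"
  have [simp]: "valid (component S T \<theta> A)" if "A \<in> Obj" for A
    using nat that by (simp add: component_valid)
  have square: "post (on_obj S A) (component S T \<theta> ?B) \<odot> hom_map S A ?B
      = pre (component S T \<theta> A) (on_obj T ?B) \<odot> hom_map T A ?B"
    using nat by (intro arrow_eqI) (simp_all add: raw_simps raw_post raw_pre enriched_natural_def)
  have "component S T \<theta> ?B \<odot> act S A C g
      = ev (on_obj S A) (on_obj T ?B)
        \<odot> (Id (on_obj S A) \<otimes> (post (on_obj S A) (component S T \<theta> ?B) \<odot> (hom_map S A ?B \<odot> cur A C g)))"
    by (subst ev_post) (simp_all add: act_def)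
  also have "post (on_obj S A) (component S T \<theta> ?B) \<odot> (hom_map S A ?B \<odot> cur A C g)
      = (post (on_obj S A) (component S T \<theta> ?B) \<odot> hom_map S A ?B) \<odot> cur A C g"
    by simp
  also have "\<dots> = pre (component S T \<theta> A) (on_obj T ?B) \<odot> (hom_map T A ?B \<odot> cur A C g)"
    by (simp add: square)
  also have "ev (on_obj S A) (on_obj T ?B) \<odot> (Id (on_obj S A) \<otimes> \<dots>)
      = act T A C g \<odot> (component S T \<theta> A \<otimes> Id C)"
    by (subst ev_pre) (simp_all add: act_def)
  finally show ?thesis .
qed

lemma fmap_enriched_natural:
  assumes [simp]: "typed_functor S" "typed_functor T" and nat: "enriched_natural X S T \<theta>"
    and [simp]: "valid f"
  shows "component S T \<theta> (tgt f) \<odot> fmap S f = fmap T f \<odot> component S T \<theta> (src f)"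
proof -
  have [simp]: "valid (component S T \<theta> A)" if "A \<in> Obj" for A
    using nat that by (simp add: component_valid)
  have "component S T \<theta> (tgt f) \<odot> fmap S f
      = (component S T \<theta> (tgt f) \<odot> act S (src f) \<I> (f \<odot> Ru (src f))) \<odot> Ru_inv (on_obj S (src f))"
    by (simp add: fmap_def)
  also have "\<dots> = fmap T f \<odot> (Ru (on_obj T (src f)) \<odot> (component S T \<theta> (src f) \<otimes> Id \<I>))
      \<odot> Ru_inv (on_obj S (src f))"
    using act_enriched_natural[OF assms(1,2) nat, of "src f" \<I> "f \<odot> Ru (src f)"]
    by (simp add: fmap_Ru)
  also have "\<dots> = fmap T f \<odot> component S T \<theta> (src f)"
    using Ru_natural[of "component S T \<theta> (src f)"] by simp
  finally show ?thesis .
qed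

section \<open>Composite functors, as needed for naturality of a multiplication\<close>

lemma typed_functor_composite:
  assumes "typed_functor S" "typed_functor T"
  shows "typed_functor (composite_functor X S T)"
proof -
  have "raw (hom_map S (on_obj T A) (on_obj T B) \<odot> hom_map T A B)
      \<in> Hom (A \<multimap> B) (on_obj S (on_obj T A) \<multimap> on_obj S (on_obj T B))"
    if "A \<in> Obj" "B \<in> Obj" for A B
    using that assms valid_simps(1)[of "hom_map S (on_obj T A) (on_obj T B)" "hom_map T A B"]
    unfolding valid_def[of "_ \<odot> _"] by simp
  with assms show ?thesis
    unfolding typed_functor_def by (simp add: composite_functor_def raw_simps)
qed

text \<open>By \<open>cur_act\<close> the transpose of \<open>act T\<close> is again a composite
  with \<open>hom_map T\<close>, so actions compose. This turns naturality of a multiplication into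
  an equation with iterated \<open>fmap\<close>.\<close>

lemma fmap_composite:
  assumes "typed_functor S" "typed_functor T" "valid f"
  shows "fmap (composite_functor X S T) f = fmap S (fmap T f)"
proof -
  have on_obj: "on_obj (composite_functor X S T) A = on_obj S (on_obj T A)" for A
    by (simp add: composite_functor_def)
  have hom_map: "hom_map (composite_functor X S T) A B
      = hom_map S (on_obj T A) (on_obj T B) \<odot> hom_map T A B" for A B
    by (simp add: composite_functor_def hom_map_def comp_arr_def)
  have "act (composite_functor X S T) (src f) \<I> (f \<odot> Ru (src f))
      = act S (on_obj T (src f)) \<I> (act T (src f) \<I> (f \<odot> Ru (src f)))"
    using assms by (simp add: act_def[of "composite_functor X S T"] act_def[of S] on_obj hom_map cur_act)
  also have "\<dots> = fmap S (fmap T f) \<odot> Ru (on_obj S (on_obj T (src f)))"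
    using assms fmap_Ru[of S "fmap T f"] by (simp add: fmap_Ru)
  finally show ?thesis
    using assms by (simp add: fmap_def[of "composite_functor X S T"] on_obj)
qed

section \<open>Pointwise algebras\<close>

definition pointwise ::
    "('o, 'a, 'n) enriched_functor_scheme \<Rightarrow> 'o \<Rightarrow> ('o, 'a) typed_arrow \<Rightarrow> ('o, 'a) typed_arrow" where
  "pointwise T A b = post A b
     \<odot> cur A (on_obj T (A \<multimap> tgt b)) (fmap T (ev A (tgt b)) \<odot> tr T A (A \<multimap> tgt b))"

lemma pointwise_src_tgt [simp]:
  "src (pointwise T A b) = on_obj T (A \<multimap> tgt b)" "tgt (pointwise T A b) = A \<multimap> tgt b"
  by (simp_all add: pointwise_def)

lemma pointwise_valid [simp]:
  "\<lbrakk>typed_functor T; A \<in> Obj; valid b; src b = on_obj T (tgt b)\<rbrakk> \<Longrightarrow> valid (pointwise T A b)"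
  by (simp add: pointwise_def)

lemma raw_pointwise:
  assumes "src b = on_obj T (tgt b)"
  shows "(A \<multimap> tgt b, raw (pointwise T A b)) = pointwise_algebra X T A (tgt b, raw b)"
  using assms
  by (simp add: pointwise_algebra_def pointwise_def raw_simps raw_post cur_def
      cotensor_strength_def raw_fmap raw_tr) (simp add: ev_def)

lemma ev_pointwise:
  assumes "typed_functor T" "A \<in> Obj" "valid b" "src b = on_obj T (tgt b)" "tgt b = Z"
  shows "ev A Z \<odot> (Id A \<otimes> pointwise T A b) = b \<odot> fmap T (ev A Z) \<odot> tr T A (A \<multimap> Z)"
proof -
  have "Z \<in> Obj" using assms by auto
  with assms show ?thesis by (simp add: pointwise_def ev_post)
qed

end

section \<open>Extenders along a morphism of monads\<close>

locale enriched_monad_morphism = symmetric_monoidal_closed_category X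
  for X :: "('o, 'a, 'm) monoidal_closed_category_scheme" (structure) +
  fixes L M :: "('o, 'a) enriched_monad"
    and \<Delta> :: "'o \<Rightarrow> 'a"
  assumes monad_L: "is_enriched_monad X L"
    and monad_M: "is_enriched_monad X M"
    and morphism: "is_monad_morphism X L M \<Delta>"
begin

lemma functor_L: "is_enriched_functor X L" and functor_M: "is_enriched_functor X M"
  using monad_L monad_M by (simp_all add: is_enriched_monad_def)

lemma typed_L [simp]: "typed_functor L" and typed_M [simp]: "typed_functor M"
  by (simp_all add: typed_functor_if_enriched functor_L functor_M)

definition D :: "'o \<Rightarrow> ('o, 'a) typed_arrow" where
  "D = component L M \<Delta>"

definition unit_M :: "'o \<Rightarrow> ('o, 'a) typed_arrow" where
  "unit_M A = Arrow A (on_obj M A) (unit_of M A)"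

definition mult_M :: "'o \<Rightarrow> ('o, 'a) typed_arrow" where
  "mult_M A = Arrow (on_obj M (on_obj M A)) (on_obj M A) (mult_of M A)"

lemma monad_src_tgt [simp]:
  "src (D A) = on_obj L A" "tgt (D A) = on_obj M A" "raw (D A) = \<Delta> A"
  "src (unit_M A) = A" "tgt (unit_M A) = on_obj M A" "raw (unit_M A) = unit_of M A"
  "src (mult_M A) = on_obj M (on_obj M A)" "tgt (mult_M A) = on_obj M A"
  "raw (mult_M A) = mult_of M A"
  by (simp_all add: D_def unit_M_def mult_M_def)

text \<open>Brings the multiplication under the general naturality lemmas, which speak of components
  between two functors.\<close>

lemma mult_M_component: "mult_M = component (composite_functor X M M) M (mult_of M)"
  by (simp add: mult_M_def component_def composite_functor_def fun_eq_iff)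

lemma monad_valid [simp]:
  assumes "A \<in> Obj"
  shows "valid (D A)" "valid (unit_M A)" "valid (mult_M A)"
proof -
  show "valid (D A)"
    using assms morphism by (simp add: D_def component_valid is_monad_morphism_def)
  show "valid (mult_M A)"
    using assms monad_M
    by (simp add: mult_M_component component_valid typed_functor_composite is_enriched_monad_def)
  have "on_obj M A \<in> Obj" using assms by simp
  with assms monad_M show "valid (unit_M A)"
    by (simp add: valid_def is_enriched_monad_def enriched_natural_def identity_functor_def del: valid_obj)
qed

lemma D_natural: "valid f \<Longrightarrow> D (tgt f) \<odot> fmap L f = fmap M f \<odot> D (src f)"
  unfolding D_def using morphism by (intro fmap_enriched_natural) (simp_all add: is_monad_morphism_def)

lemma mult_M_natural:
  assumes "valid f"
  shows "mult_M (tgt f) \<odot> fmap M (fmap M f) = fmap M f \<odot> mult_M (src f)"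
  using fmap_enriched_natural[of "composite_functor X M M" M "mult_of M" f] assms monad_M
  by (simp add: mult_M_component typed_functor_composite fmap_composite is_enriched_monad_def)

lemma mult_M_unit: "A \<in> Obj \<Longrightarrow> mult_M A \<odot> fmap M (unit_M A) = Id (on_obj M A)"
  using monad_M by (intro arrow_eqI) (simp_all add: raw_simps raw_fmap is_enriched_monad_def Id_def)

section \<open>Extenders and the two relative tensors\<close>

definition ext :: "'o \<Rightarrow> ('o, 'a) typed_arrow \<Rightarrow> ('o, 'a) typed_arrow" where
  "ext A a = post (on_obj M A) a \<odot> hom_map M A (tgt a)"

definition rel_tensor :: "'o \<Rightarrow> 'o \<Rightarrow> ('o, 'a) typed_arrow" where
  "rel_tensor A B = ((mult_M (A \<boxtimes> B) \<odot> D (on_obj M (A \<boxtimes> B))) \<odot> fmap L (tl M A B))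
     \<odot> tr L (on_obj M A) B"

definition rel_tensor' :: "'o \<Rightarrow> 'o \<Rightarrow> ('o, 'a) typed_arrow" where
  "rel_tensor' A B = ((mult_M (A \<boxtimes> B) \<odot> fmap M (D (A \<boxtimes> B))) \<odot> fmap M (tr L A B))
     \<odot> tl M A (on_obj L B)"

lemma rel_tensor_simps [simp]:
  "src (rel_tensor A B) = on_obj M A \<boxtimes> on_obj L B" "tgt (rel_tensor A B) = on_obj M (A \<boxtimes> B)"
  "src (rel_tensor' A B) = on_obj M A \<boxtimes> on_obj L B" "tgt (rel_tensor' A B) = on_obj M (A \<boxtimes> B)"
  "\<lbrakk>A \<in> Obj; B \<in> Obj\<rbrakk> \<Longrightarrow> valid (rel_tensor A B)"
  "\<lbrakk>A \<in> Obj; B \<in> Obj\<rbrakk> \<Longrightarrow> valid (rel_tensor' A B)"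
  by (simp_all add: rel_tensor_def rel_tensor'_def)

lemma relatively_commutative_iff:
  "relatively_commutative X L M \<Delta> \<longleftrightarrow> (\<forall>A\<in>Obj. \<forall>B\<in>Obj. rel_tensor A B = rel_tensor' A B)"
proof -
  have "raw (rel_tensor A B) = relative_tensor X L M \<Delta> A B"
    and "raw (rel_tensor' A B) = relative_tensor' X L M \<Delta> A B" for A B
    by (simp_all add: rel_tensor_def rel_tensor'_def relative_tensor_def relative_tensor'_def
        raw_simps raw_fmap raw_tl raw_tr)
  \<comment> \<open>Both typed arrows have the same source and target, so comparing raw arrows is
    enough.\<close>
  then have "rel_tensor A B = rel_tensor' A B
      \<longleftrightarrow> relative_tensor X L M \<Delta> A B = relative_tensor' X L M \<Delta> A B" for A B
    by (metis arrow_eqI rel_tensor_simps(1-4))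
  then show ?thesis by (simp add: relatively_commutative_def)
qed

text \<open>The arrow \<open>c\<close> is pushed leftwards through the four factors in turn:
  \<open>tr\<close>, then \<open>tl\<close> under \<open>L\<close>, then \<open>D\<close>, then the
  multiplication.\<close>

lemma rel_tensor_natural:
  assumes [simp]: "A \<in> Obj" "valid c"
  shows "rel_tensor A (tgt c) \<odot> (Id (on_obj M A) \<otimes> fmap L c)
      = fmap M (Id A \<otimes> c) \<odot> rel_tensor A (src c)"
proof -
  let ?M = "on_obj M"
  have "rel_tensor A (tgt c) \<odot> (Id (?M A) \<otimes> fmap L c)
      = mult_M (A \<boxtimes> tgt c) \<odot> D (?M (A \<boxtimes> tgt c)) \<odot> fmap L (tl M A (tgt c))
        \<odot> (tr L (?M A) (tgt c) \<odot> (Id (?M A) \<otimes> fmap L c))"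
    by (simp add: rel_tensor_def)
  also have "\<dots> = mult_M (A \<boxtimes> tgt c) \<odot> D (?M (A \<boxtimes> tgt c))
        \<odot> fmap L (tl M A (tgt c) \<odot> (Id (?M A) \<otimes> c)) \<odot> tr L (?M A) (src c)"
    by (simp add: tr_natural functor_L fmap_comp)
  also have "\<dots> = mult_M (A \<boxtimes> tgt c) \<odot> (D (?M (A \<boxtimes> tgt c)) \<odot> fmap L (fmap M (Id A \<otimes> c)))
        \<odot> fmap L (tl M A (src c)) \<odot> tr L (?M A) (src c)"
    by (simp add: tl_natural functor_L functor_M fmap_comp)
  also have "\<dots> = (mult_M (A \<boxtimes> tgt c) \<odot> fmap M (fmap M (Id A \<otimes> c)))
        \<odot> D (?M (A \<boxtimes> src c)) \<odot> fmap L (tl M A (src c)) \<odot> tr L (?M A) (src c)"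
    using D_natural[of "fmap M (Id A \<otimes> c)"] by simp
  also have "\<dots> = fmap M (Id A \<otimes> c) \<odot> rel_tensor A (src c)"
    using mult_M_natural[of "Id A \<otimes> c"] by (simp add: rel_tensor_def)
  finally show ?thesis .
qed

text \<open>The same passage in the other order of strengths: \<open>tl\<close> first, then
  \<open>tr\<close> and \<open>D\<close> under \<open>M\<close>, then the multiplication.\<close>

lemma rel_tensor'_natural:
  assumes [simp]: "A \<in> Obj" "valid c"
  shows "rel_tensor' A (tgt c) \<odot> (Id (on_obj M A) \<otimes> fmap L c)
      = fmap M (Id A \<otimes> c) \<odot> rel_tensor' A (src c)"
proof -
  have "rel_tensor' A (tgt c) \<odot> (Id (on_obj M A) \<otimes> fmap L c)
      = mult_M (A \<boxtimes> tgt c) \<odot> fmap M (D (A \<boxtimes> tgt c)) \<odot> fmap M (tr L A (tgt c))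
        \<odot> (tl M A (on_obj L (tgt c)) \<odot> (Id (on_obj M A) \<otimes> fmap L c))"
    by (simp add: rel_tensor'_def)
  also have "\<dots> = mult_M (A \<boxtimes> tgt c) \<odot> fmap M (D (A \<boxtimes> tgt c))
        \<odot> fmap M (tr L A (tgt c) \<odot> (Id A \<otimes> fmap L c)) \<odot> tl M A (on_obj L (src c))"
    using tl_natural[OF functor_M, of A "fmap L c"] by (simp add: functor_M fmap_comp)
  also have "\<dots> = mult_M (A \<boxtimes> tgt c) \<odot> fmap M (D (A \<boxtimes> tgt c) \<odot> fmap L (Id A \<otimes> c))
        \<odot> fmap M (tr L A (src c)) \<odot> tl M A (on_obj L (src c))"
    by (simp add: tr_natural functor_L functor_M fmap_comp)
  also have "\<dots> = (mult_M (A \<boxtimes> tgt c) \<odot> fmap M (fmap M (Id A \<otimes> c)))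
        \<odot> fmap M (D (A \<boxtimes> src c)) \<odot> fmap M (tr L A (src c)) \<odot> tl M A (on_obj L (src c))"
    using D_natural[of "Id A \<otimes> c"] by (simp add: functor_M fmap_comp)
  also have "\<dots> = fmap M (Id A \<otimes> c) \<odot> rel_tensor' A (src c)"
    using mult_M_natural[of "Id A \<otimes> c"] by (simp add: rel_tensor'_def)
  finally show ?thesis .
qed

section \<open>Transposing the homomorphism condition\<close>

definition structure_arr :: "('o, 'a) typed_arrow \<Rightarrow> bool" where
  "structure_arr a \<longleftrightarrow> valid a \<and> src a = on_obj M (tgt a) \<and> a \<odot> mult_M (tgt a) = a \<odot> fmap M a"

lemma structure_arr_if_algebra:
  assumes "is_algebra X M Z a"
  shows "structure_arr (Arrow (on_obj M Z) Z a)"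
proof -
  have Z: "Z \<in> Obj" using assms by (simp add: is_algebra_def)
  then have "on_obj M Z \<in> Obj" by simp
  with Z assms show ?thesis
    unfolding structure_arr_def
    by (auto intro!: arrow_eqI simp: is_algebra_def valid_def raw_simps raw_fmap simp del: valid_obj)
qed

lemma ext_simps [simp]:
  "src (ext A a) = A \<multimap> tgt a" "tgt (ext A a) = on_obj M A \<multimap> tgt a"
  "\<lbrakk>A \<in> Obj; valid a; src a = on_obj M (tgt a)\<rbrakk> \<Longrightarrow> valid (ext A a)"
  by (simp_all add: ext_def)

text \<open>The family \<open>ev A Z\<close> has the identity as its transpose, so evaluating
  \<open>hom_map\<close> is the action of \<open>M\<close> on \<open>ev A Z\<close>, which factors
  through \<open>tl\<close>.\<close>

lemma ev_ext:
  assumes "A \<in> Obj" "valid a" "src a = on_obj M (tgt a)" "tgt a = Z"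
  shows "ev (on_obj M A) Z \<odot> (Id (on_obj M A) \<otimes> ext A a)
    = a \<odot> fmap M (ev A Z) \<odot> tl M A (A \<multimap> Z)"
proof -
  have Z: "Z \<in> Obj" using assms by auto
  then have "cur A (A \<multimap> Z) (ev A Z) = Id (A \<multimap> Z)"
    using cur_ev[of A Z "Id (A \<multimap> Z)"] assms by simp
  with Z assms have "act M A (A \<multimap> Z) (ev A Z)
      = ev (on_obj M A) (on_obj M Z) \<odot> (Id (on_obj M A) \<otimes> hom_map M A Z)"
    by (simp add: act_def)
  then show ?thesis
    using Z assms by (simp add: ext_def ev_post flip: act_eq_fmap_tl[OF functor_M])
qed

text \<open>Naturality of \<open>tl\<close> moves the pointwise structure under \<open>M\<close>,
  where evaluating it exposes \<open>tr\<close>. The order \<open>tl\<close> before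
  \<open>tr\<close> is that of \<open>rel_tensor'\<close>.\<close>

lemma ev_ext_pointwise:
  assumes [simp]: "A \<in> Obj" and a: "structure_arr a" "tgt a = Z"
  shows "ev (on_obj M A) Z \<odot> (Id (on_obj M A) \<otimes> (ext A a \<odot> pointwise L A (a \<odot> D Z)))
    = a \<odot> fmap M (ev A Z) \<odot> rel_tensor' A (A \<multimap> Z)"
proof -
  have [simp]: "valid a" "src a = on_obj M Z" "Z \<in> Obj" "tgt a = Z"
    and alg: "a \<odot> fmap M a = a \<odot> mult_M Z"
    using a by (auto simp: structure_arr_def)
  let ?p = "pointwise L A (a \<odot> D Z)" and ?W = "A \<multimap> Z"
  have [simp]: "valid ?p" by simp
  have "ev (on_obj M A) Z \<odot> (Id (on_obj M A) \<otimes> (ext A a \<odot> ?p))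
      = (ev (on_obj M A) Z \<odot> (Id (on_obj M A) \<otimes> ext A a)) \<odot> (Id (on_obj M A) \<otimes> ?p)"
    by simp
  also have "\<dots> = a \<odot> fmap M (ev A Z) \<odot> (tl M A ?W \<odot> (Id (on_obj M A) \<otimes> ?p))"
    by (simp add: ev_ext)
  also have "\<dots> = a \<odot> fmap M (ev A Z \<odot> (Id A \<otimes> ?p)) \<odot> tl M A (on_obj L ?W)"
    using tl_natural[OF functor_M, of A ?p] by (simp add: fmap_comp functor_M)
  also have "ev A Z \<odot> (Id A \<otimes> ?p) = a \<odot> (D Z \<odot> fmap L (ev A Z)) \<odot> tr L A ?W"
    by (simp add: ev_pointwise)
  \<comment> \<open>Moving \<open>D\<close> to the right of the evaluation brings \<open>a\<close>
    next to \<open>fmap M a\<close> with two copies of \<open>M\<close> behind, ready for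
    associativity and naturality of the multiplication.\<close>
  also have "D Z \<odot> fmap L (ev A Z) = fmap M (ev A Z) \<odot> D (A \<boxtimes> ?W)"
    using D_natural[of "ev A Z"] by simp
  also have "a \<odot> fmap M (a \<odot> (fmap M (ev A Z) \<odot> D (A \<boxtimes> ?W)) \<odot> tr L A ?W) \<odot> tl M A (on_obj L ?W)
      = (a \<odot> fmap M a) \<odot> fmap M (fmap M (ev A Z)) \<odot> fmap M (D (A \<boxtimes> ?W)) \<odot> fmap M (tr L A ?W)
        \<odot> tl M A (on_obj L ?W)"
    by (simp add: fmap_comp functor_M)
  also have "\<dots> = a \<odot> (mult_M Z \<odot> fmap M (fmap M (ev A Z))) \<odot> fmap M (D (A \<boxtimes> ?W))
        \<odot> fmap M (tr L A ?W) \<odot> tl M A (on_obj L ?W)"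
    by (simp add: alg)
  also have "\<dots> = a \<odot> fmap M (ev A Z) \<odot> rel_tensor' A ?W"
    using mult_M_natural[of "ev A Z"] by (simp add: rel_tensor'_def)
  finally show ?thesis .
qed

text \<open>Here the pointwise structure is evaluated first, exposing \<open>tr\<close>; its
  naturality moves the extender under \<open>L\<close>, where evaluation exposes \<open>tl\<close>.
  This is the order of \<open>rel_tensor\<close>.\<close>

lemma ev_pointwise_ext:
  assumes [simp]: "A \<in> Obj" and a: "structure_arr a" "tgt a = Z"
  shows "ev (on_obj M A) Z
      \<odot> (Id (on_obj M A) \<otimes> (pointwise L (on_obj M A) (a \<odot> D Z) \<odot> fmap L (ext A a)))
    = a \<odot> fmap M (ev A Z) \<odot> rel_tensor A (A \<multimap> Z)"
proof -
  have [simp]: "valid a" "src a = on_obj M Z" "Z \<in> Obj" "tgt a = Z"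
    and alg: "a \<odot> fmap M a = a \<odot> mult_M Z"
    using a by (auto simp: structure_arr_def)
  let ?MA = "on_obj M A" and ?W = "A \<multimap> Z"
  let ?p = "pointwise L ?MA (a \<odot> D Z)" and ?e = "ext A a"
  have [simp]: "valid ?p" "valid ?e" by simp_all
  have "ev ?MA Z \<odot> (Id ?MA \<otimes> (?p \<odot> fmap L ?e)) = (ev ?MA Z \<odot> (Id ?MA \<otimes> ?p)) \<odot> (Id ?MA \<otimes> fmap L ?e)"
    by simp
  also have "\<dots> = a \<odot> D Z \<odot> fmap L (ev ?MA Z) \<odot> (tr L ?MA (?MA \<multimap> Z) \<odot> (Id ?MA \<otimes> fmap L ?e))"
    by (simp add: ev_pointwise)
  also have "\<dots> = a \<odot> D Z \<odot> fmap L (ev ?MA Z \<odot> (Id ?MA \<otimes> ?e)) \<odot> tr L ?MA ?W"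
    using tr_natural[OF functor_L, of ?MA ?e] by (simp add: fmap_comp functor_L)
  also have "ev ?MA Z \<odot> (Id ?MA \<otimes> ?e) = (a \<odot> fmap M (ev A Z)) \<odot> tl M A ?W"
    by (simp add: ev_ext)
  also have "a \<odot> D Z \<odot> fmap L ((a \<odot> fmap M (ev A Z)) \<odot> tl M A ?W) \<odot> tr L ?MA ?W
      = a \<odot> (D Z \<odot> fmap L (a \<odot> fmap M (ev A Z))) \<odot> fmap L (tl M A ?W) \<odot> tr L ?MA ?W"
    by (simp add: fmap_comp functor_L)
  \<comment> \<open>\<open>D\<close> is natural at the whole arrow
    \<open>a \<odot> fmap M (ev A Z)\<close>; this converts \<open>fmap L a\<close> into the
    \<open>fmap M a\<close> that associativity requires.\<close>
  also have "\<dots> = (a \<odot> fmap M a) \<odot> fmap M (fmap M (ev A Z)) \<odot> D (on_obj M (A \<boxtimes> ?W))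
        \<odot> fmap L (tl M A ?W) \<odot> tr L ?MA ?W"
    using D_natural[of "a \<odot> fmap M (ev A Z)"] by (simp add: fmap_comp[OF functor_M])
  also have "\<dots> = a \<odot> (mult_M Z \<odot> fmap M (fmap M (ev A Z))) \<odot> D (on_obj M (A \<boxtimes> ?W))
        \<odot> fmap L (tl M A ?W) \<odot> tr L ?MA ?W"
    by (simp add: alg)
  also have "\<dots> = a \<odot> fmap M (ev A Z) \<odot> rel_tensor A ?W"
    using mult_M_natural[of "ev A Z"] by (simp add: rel_tensor_def)
  finally show ?thesis .
qed

text \<open>Transposition is injective by \<open>ev_cancel\<close>, so the homomorphism equation may
  be tested after evaluation, where the two preceding lemmas compute its sides.\<close>

lemma extender_is_hom_iff:
  assumes "A \<in> Obj" and alg: "is_algebra X M Z a"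
  shows "extender_is_hom X L M \<Delta> A Z a
    \<longleftrightarrow> Arrow (on_obj M Z) Z a \<odot> fmap M (ev A Z) \<odot> rel_tensor A (A \<multimap> Z)
      = Arrow (on_obj M Z) Z a \<odot> fmap M (ev A Z) \<odot> rel_tensor' A (A \<multimap> Z)"
proof -
  let ?a = "Arrow (on_obj M Z) Z a" and ?MA = "on_obj M A"
  let ?p = "\<lambda>A. pointwise L A (?a \<odot> D Z)"
  have a: "structure_arr ?a" using alg by (rule structure_arr_if_algebra)
  then have [simp]: "valid ?a" by (simp add: structure_arr_def)
  then have [simp]: "Z \<in> Obj" using valid_obj(2)[of ?a] by simp
  have ext_valid: "valid (ext A ?a)" using assms(1) by simp
  have raw_ext: "raw (ext A ?a) = extender X M A Z a"
    by (simp add: ext_def extender_def raw_simps raw_post)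
  have p: "pointwise_algebra X L A (restricted_algebra X \<Delta> (Z, a)) = (A \<multimap> Z, raw (?p A))" for A
    using raw_pointwise[of "?a \<odot> D Z" L A] by (simp add: restricted_algebra_def raw_simps)
  \<comment> \<open>This settles the typing clause of \<open>is_algebra_hom\<close>, leaving only
    its equation.\<close>
  have "raw (ext A ?a) \<in> Hom (A \<multimap> Z) (?MA \<multimap> Z)"
    using ext_valid unfolding valid_def by simp
  then have "extender_is_hom X L M \<Delta> A Z a
      \<longleftrightarrow> raw (ext A ?a \<odot> ?p A) = raw (?p ?MA \<odot> fmap L (ext A ?a))"
    by (simp add: extender_is_hom_def p is_algebra_hom_def raw_simps raw_fmap flip: raw_ext)
  also have "\<dots> \<longleftrightarrow> ext A ?a \<odot> ?p A = ?p ?MA \<odot> fmap L (ext A ?a)"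
    by (auto intro: arrow_eqI)
  also have "\<dots> \<longleftrightarrow> ev ?MA Z \<odot> (Id ?MA \<otimes> (ext A ?a \<odot> ?p A))
      = ev ?MA Z \<odot> (Id ?MA \<otimes> (?p ?MA \<odot> fmap L (ext A ?a)))"
    using assms(1) ext_valid by (auto intro: ev_cancel[of ?MA Z])
  finally show ?thesis
    using ev_ext_pointwise[OF assms(1) a] ev_pointwise_ext[OF assms(1) a] by auto
qed

section \<open>Free algebras and the equivalence\<close>

lemma is_algebra_free:
  assumes "B \<in> Obj"
  shows "is_algebra X M (on_obj M B) (mult_of M B)"
proof -
  have "valid (mult_M B)" using assms by simp
  with monad_M assms show ?thesis
    by (simp add: is_algebra_def is_enriched_monad_def valid_def del: valid_obj)
qed

text \<open>Evaluating the transpose of the unit returns the unit, so the arrows before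
  \<open>r\<close> reduce to the unit law \<open>mult_M_unit\<close>. The trailing \<open>r\<close>
  fits right-nested composites.\<close>

lemma free_algebra_cancel:
  assumes [simp]: "A \<in> Obj" "B \<in> Obj" "valid r" "tgt r = on_obj M (A \<boxtimes> B)"
  shows "mult_M (A \<boxtimes> B) \<odot> fmap M (ev A (on_obj M (A \<boxtimes> B)))
      \<odot> fmap M (Id A \<otimes> cur A B (unit_M (A \<boxtimes> B))) \<odot> r = r"
proof -
  let ?Z = "on_obj M (A \<boxtimes> B)" and ?c = "cur A B (unit_M (A \<boxtimes> B))"
  have "mult_M (A \<boxtimes> B) \<odot> fmap M (ev A ?Z) \<odot> fmap M (Id A \<otimes> ?c) \<odot> r
      = (mult_M (A \<boxtimes> B) \<odot> fmap M (ev A ?Z \<odot> (Id A \<otimes> ?c))) \<odot> r"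
    by (simp add: fmap_comp functor_M del: ev_cur)
  also have "\<dots> = r" by (simp add: mult_M_unit)
  finally show ?thesis .
qed

lemma relatively_commutative_if_extenders:
  assumes "\<forall>A\<in>Obj. \<forall>B\<in>Obj. extender_is_hom X L M \<Delta> A (on_obj M B) (mult_of M B)"
  shows "relatively_commutative X L M \<Delta>"
  unfolding relatively_commutative_iff
proof (intro ballI)
  fix A B
  assume [simp]: "A \<in> Obj" "B \<in> Obj"
  let ?Z = "on_obj M (A \<boxtimes> B)" and ?c = "cur A B (unit_M (A \<boxtimes> B))"
  let ?W = "A \<multimap> ?Z" and ?k = "mult_M (A \<boxtimes> B) \<odot> fmap M (ev A ?Z)"
  have "extender_is_hom X L M \<Delta> A ?Z (mult_of M (A \<boxtimes> B))" using assms by simp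
  then have eq: "?k \<odot> rel_tensor A ?W = ?k \<odot> rel_tensor' A ?W"
    \<comment> \<open>Folding \<open>mult_M_def\<close> recognises the typed structure map of the
      free algebra as \<open>mult_M\<close>.\<close>
    by (simp add: extender_is_hom_iff is_algebra_free flip: mult_M_def)
  \<comment> \<open>By naturality, precomposition with \<open>fmap L ?c\<close> carries both tensors
    from \<open>?W\<close> back to \<open>B\<close> and leaves
    \<open>fmap M (Id A \<otimes> ?c)\<close> behind \<open>?k\<close>, a composite that
    cancels.\<close>
  have "(?k \<odot> rel_tensor A ?W) \<odot> (Id (on_obj M A) \<otimes> fmap L ?c)
      = (?k \<odot> rel_tensor' A ?W) \<odot> (Id (on_obj M A) \<otimes> fmap L ?c)"
    by (simp only: eq)
  then show "rel_tensor A B = rel_tensor' A B"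
    using rel_tensor_natural[of A ?c] rel_tensor'_natural[of A ?c]
    by (simp add: free_algebra_cancel)
qed

lemma extenders_if_relatively_commutative:
  assumes "relatively_commutative X L M \<Delta>" "A \<in> Obj" "is_algebra X M Z a"
  shows "extender_is_hom X L M \<Delta> A Z a"
proof -
  have "Z \<in> Obj" using assms(3) by (simp add: is_algebra_def)
  with assms show ?thesis
    by (simp add: extender_is_hom_iff relatively_commutative_iff)
qed

end

theorem theorem8p6p14:
  fixes X :: "('o, 'a, 'm) monoidal_closed_category_scheme" (structure)
    and L M :: "('o, 'a) enriched_monad"
    and \<Delta> :: "'o \<Rightarrow> 'a"
  assumes "symmetric_monoidal_closed_category X"
    and "is_enriched_monad X L"
    and "is_enriched_monad X M"
    and "is_monad_morphism X L M \<Delta>"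
    and "commutative_monad X L"
    and "has_algebra_tensor_products X L"
    and "enriched_eilenberg_moore_exists X L"
  shows "(relatively_commutative X L M \<Delta> \<longleftrightarrow>
            (\<forall>A\<in>Obj. \<forall>B\<in>Obj. extender_is_hom X L M \<Delta> A (on_obj M B) (mult_of M B))) \<and>
         (relatively_commutative X L M \<Delta> \<longleftrightarrow>
            (\<forall>A\<in>Obj. \<forall>Z a. is_algebra X M Z a \<longrightarrow> extender_is_hom X L M \<Delta> A Z a))"
proof -
  interpret symmetric_monoidal_closed_category X by (rule assms(1))
  interpret enriched_monad_morphism X L M \<Delta>
    by unfold_locales (rule assms)+
  \<comment> \<open>The cycle is: relative commutativity gives the condition for all algebras, which
    specialises to free ones by \<open>is_algebra_free\<close>, and these give relative
    commutativity back.\<close>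
  show ?thesis
    using relatively_commutative_if_extenders extenders_if_relatively_commutative is_algebra_free
    by blast
qed

end
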